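(* Let $G$ be a planar graph with minimum degree $\delta(G)\ge 2$ and girth $g(G)\ge 10$. Then $\chi_{eq}^*(G)\le 4$; that is, $G$ has an equitable $n$-coloring for every integer $n\ge 4$.
   Context: A proper vertex $k$-coloring of a graph $G$ is equitable if the sizes of any two color classes differ by at most one (i.e. with color classes $V_1,\dots,V_k$ ordered so that $|V_1|\le\dots\le|V_k|$, one has $|V_k|\le |V_1|+1$). The equitable chromatic threshold $\chi_{eq}^*(G)$ is the smallest integer $m$ such that $G$ is equitably $n$-colorable for all $n\ge m$. The girth $g(G)$ is the length of a shortest cycle in $G$. *)

theory Defs
  imports "HOL-Analysis.Analysis" "HOL-Library.Extended_Nat"
begin

definition simple_graph :: "'a set \<Rightarrow> 'a set set \<Rightarrow> bool" where
  "simple_graph V E \<longleftrightarrow> finite V \<and> (\<forall>e\<in>E. e \<subseteq> V \<and> card e = 2)"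

definition vertex_degree :: "'a set set \<Rightarrow> 'a \<Rightarrow> nat" where
  "vertex_degree E v = card {e \<in> E. v \<in> e}"

text \<open>The values of the next two invariants are extended naturals, so that an infimum over
  the empty set (the null graph, respectively an acyclic graph) is \<open>\<infinity>\<close>.\<close>

definition min_degree :: "'a set \<Rightarrow> 'a set set \<Rightarrow> enat" where
  "min_degree V E = (INF v\<in>V. enat (vertex_degree E v))"

text \<open>A cycle is given by the list of its vertices, without repeating the first one at the end;
  its length as a list is its number of edges.\<close>

definition is_cycle :: "'a set \<Rightarrow> 'a set set \<Rightarrow> 'a list \<Rightarrow> bool" where
  "is_cycle V E c \<longleftrightarrow> length c \<ge> 3 \<and> distinct c \<and> set c \<subseteq> V \<and>
     (\<forall>i<length c. {c ! i, c ! (Suc i mod length c)} \<in> E)"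

definition girth :: "'a set \<Rightarrow> 'a set set \<Rightarrow> enat" where
  "girth V E = (INF c\<in>{c. is_cycle V E c}. enat (length c))"

text \<open>The plane is the type \<^typ>\<open>complex\<close>. Vertices are drawn as distinct points and each
  edge as a simple arc joining its two ends that meets no other vertex; two distinct edges meet
  at most in common ends.\<close>

definition plane_drawing ::
  "'a set \<Rightarrow> 'a set set \<Rightarrow> ('a \<Rightarrow> complex) \<Rightarrow> ('a set \<Rightarrow> real \<Rightarrow> complex) \<Rightarrow> bool" where
  "plane_drawing V E pos \<gamma> \<longleftrightarrow>
     inj_on pos V \<and>
     (\<forall>e\<in>E. arc (\<gamma> e) \<and> {pathstart (\<gamma> e), pathfinish (\<gamma> e)} = pos ` e \<and>
             path_image (\<gamma> e) \<inter> pos ` V = pos ` e) \<and>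
     (\<forall>e\<in>E. \<forall>f\<in>E. e \<noteq> f \<longrightarrow>
        path_image (\<gamma> e) \<inter> path_image (\<gamma> f) \<subseteq> pos ` (e \<inter> f))"

definition planar :: "'a set \<Rightarrow> 'a set set \<Rightarrow> bool" where
  "planar V E \<longleftrightarrow> (\<exists>pos \<gamma>. plane_drawing V E pos \<gamma>)"

definition proper_coloring ::
  "'a set \<Rightarrow> 'a set set \<Rightarrow> nat \<Rightarrow> ('a \<Rightarrow> nat) \<Rightarrow> bool" where
  "proper_coloring V E k f \<longleftrightarrow>
     (\<forall>v\<in>V. f v < k) \<and> (\<forall>u\<in>V. \<forall>v\<in>V. {u, v} \<in> E \<longrightarrow> f u \<noteq> f v)"

definition color_class :: "'a set \<Rightarrow> ('a \<Rightarrow> nat) \<Rightarrow> nat \<Rightarrow> 'a set" where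
  "color_class V f i = {v \<in> V. f v = i}"

text \<open>All \<open>k\<close> classes are compared, including empty ones; these are unavoidable when \<open>k\<close> exceeds
  the number of vertices.\<close>

definition equitable_coloring ::
  "'a set \<Rightarrow> 'a set set \<Rightarrow> nat \<Rightarrow> ('a \<Rightarrow> nat) \<Rightarrow> bool" where
  "equitable_coloring V E k f \<longleftrightarrow> proper_coloring V E k f \<and>
     (\<forall>i<k. \<forall>j<k. card (color_class V f j) \<le> card (color_class V f i) + 1)"

definition equitably_colorable :: "'a set \<Rightarrow> 'a set set \<Rightarrow> nat \<Rightarrow> bool" where
  "equitably_colorable V E k \<longleftrightarrow> (\<exists>f. equitable_coloring V E k f)"

definition eq_chromatic_threshold :: "'a set \<Rightarrow> 'a set set \<Rightarrow> nat" where
  "eq_chromatic_threshold V E = (LEAST m. \<forall>n\<ge>m. equitably_colorable V E n)"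

end

theory Submission
  imports Defs
begin

text \<open>A set of \<open>s \<le> n\<close> new vertices can be given distinct colours, chosen among those whose classes are
  smallest, provided that they can be ordered such that the \<open>i\<close>-th one has at most \<open>s - i\<close> coloured
  neighbours; this keeps a colouring equitable. In a minimal counterexample, one deletes a set of vertices
  that leaves all degrees at least two, and colours it back in such groups of at most four. This excludes
  threads with three inner vertices of degree two, as well as certain vertices of degree three or four
  together with the threads at them. The crucial case is a \<open>poor\<close> vertex, of degree three with threads of
  lengths 2, 1, 1, which cannot be removed on its own, but only together with a neighbouring branch vertex.
  Moving the charge \<open>4 d(v) - 10\<close> from branch vertices to vertices of degree two shows that what
  survives has average degree at least 5/2. Girth ten makes all removed sets induced trees.

  On the other hand, a plane graph of girth ten has average degree below 5/2. This is Euler's formula,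
  proved for graphs that are built from a cycle by adding ears, where the theta curve theorem splits a
  face in two; a maximal such subgraph is attached to the components of the rest at single
  vertices.\<close>

text \<open>The obstacle is the minimum degree: subgraphs do not inherit it, so a deleted set must
  leave two neighbours to every outside vertex. In the sets around a branch vertex \<open>z\<close>,
  only outside branch vertices touch the set, and each of them can spare one neighbour. Girth ten
  guarantees that they lose no more, as long as the set is shallow: two different walks from
  \<open>z\<close> to the same vertex have at least ten edges together. Deleting beyond a
  neighbouring poor vertex reaches vertices four steps from \<open>z\<close>, so two walks of five
  edges each may just close up to a 10-cycle. Their common end then starts two threads with two
  inner vertices each, and reductions at vertices of degree three show that such a vertex has degree
  at least four (\<open>two_two_legs\<close>), so it can spare both. The charge is d(v) - 5/2 scaled
  by four: this makes the deficit of a vertex of degree two the integer 2, which splits evenly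
  between the two ends of a thread with one inner vertex.\<close>

section \<open>Extending an equitable colouring by a group of vertices\<close>

text \<open>Greedy choice: the head has fewer forbidden values than \<open>R\<close> has elements.
  Removing the head and its value lowers the length and all indices by one, so the hypothesis keeps
  its form.\<close>

lemma distinct_representatives:
  assumes "finite R" and "length xs \<le> card R"
    and "\<And>i. i < length xs \<Longrightarrow> finite (B (xs ! i)) \<and> card (B (xs ! i)) + i < length xs"
    and "distinct xs"
  shows "\<exists>g. inj_on g (set xs) \<and> g ` set xs \<subseteq> R \<and> (\<forall>x\<in>set xs. g x \<notin> B x)"
  using assms
proof (induction xs arbitrary: R)
  case Nil
  then show ?case by simp
next
  case (Cons x xs)
  have "finite (B x)" "card (B x) < card R"
    using Cons.prems(2) Cons.prems(3)[of 0] by auto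
  then obtain r where r: "r \<in> R" "r \<notin> B x"
    using Cons.prems(1) by (meson card_mono leD subsetI)
  have "\<exists>g. inj_on g (set xs) \<and> g ` set xs \<subseteq> R - {r} \<and> (\<forall>x\<in>set xs. g x \<notin> B x)"
  proof (rule Cons.IH)
    show "length xs \<le> card (R - {r})"
      using Cons.prems(1,2) r by simp
    show "finite (B (xs ! i)) \<and> card (B (xs ! i)) + i < length xs" if "i < length xs" for i
      using Cons.prems(3)[of "Suc i"] that by auto
  qed (use Cons.prems in auto)
  then obtain g where g: "inj_on g (set xs)" "g ` set xs \<subseteq> R - {r}" "\<forall>x\<in>set xs. g x \<notin> B x"
    by blast
  have "inj_on (g(x := r)) (set (x # xs))"
    using g Cons.prems(4) by (auto simp: inj_on_def)
  moreover have "(g(x := r)) ` set (x # xs) \<subseteq> R"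
    using g r by auto
  moreover have "\<forall>y\<in>set (x # xs). (g(x := r)) y \<notin> B y"
    using g r by auto
  ultimately show ?case by blast
qed

text \<open>With \<open>A\<close> the set of smallest colour classes, this selects \<open>s\<close>
  classes to be enlarged: only smallest ones, or all smallest ones and some others.\<close>

lemma intermediate_set:
  assumes "finite C" "A \<subseteq> C" "s \<le> card C"
  obtains R where "R \<subseteq> C" "card R = s" "R \<subseteq> A \<or> A \<subseteq> R"
proof (cases "s \<le> card A")
  case True
  then show ?thesis
    using obtain_subset_with_card_n[of s A] assms(2) that by (metis order_trans)
next
  case False
  then have "A \<subseteq> C" "card A \<le> s" "s \<le> card C" using assms by auto
  then show ?thesis using exists_subset_between[of A s C] assms(1) that by auto
qed

text \<open>The new vertices receive pairwise distinct colours, so edges among them are harmless and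
  only neighbours in \<open>U\<close> have to be counted.\<close>

lemma equitable_extend:
  assumes U: "finite U" "equitably_colorable U E n"
    and loopless: "\<And>v. {v} \<notin> E"
    and xs: "distinct xs" "set xs \<inter> U = {}" "length xs \<le> n"
    and few: "\<And>i. i < length xs \<Longrightarrow> card {w \<in> U. {xs ! i, w} \<in> E} + i < length xs"
  shows "equitably_colorable (U \<union> set xs) E n"
proof -
  obtain f where f: "equitable_coloring U E n f"
    using U(2) by (auto simp: equitably_colorable_def)
  show ?thesis
  proof (cases "xs = []")
    case True
    then show ?thesis using U(2) by simp
  next
    case False
    define c where "c = (\<lambda>i. card (color_class U f i))"
    define m where "m = Min (c ` {..<n})"
    have "n > 0" using False xs(3) by (cases xs) auto
    then have m_in: "m \<in> c ` {..<n}" unfolding m_def by (intro Min_in) auto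
    have ge: "m \<le> c i" if "i < n" for i unfolding m_def using that by simp
    have le: "c i \<le> m + 1" if "i < n" for i
      using m_in that f by (auto simp: equitable_coloring_def c_def)
    define A where "A = {i. i < n \<and> c i = m}"
    \<comment> \<open>All classes have size \<open>m\<close> or \<open>m + 1\<close>. Adding one
      vertex to each class in \<open>R\<close> keeps this if \<open>R \<subseteq> A\<close>, and
      gives sizes \<open>m + 1\<close> and \<open>m + 2\<close> if
      \<open>A \<subseteq> R\<close>.\<close>
    obtain R where R: "R \<subseteq> {..<n}" "card R = length xs" "R \<subseteq> A \<or> A \<subseteq> R"
      using intermediate_set[of "{..<n}" A "length xs"] xs(3) unfolding A_def by auto
    have finR: "finite R" using R(1) finite_subset by blast
    have "\<exists>g. inj_on g (set xs) \<and> g ` set xs \<subseteq> R \<and>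
        (\<forall>x\<in>set xs. g x \<notin> f ` {w \<in> U. {x, w} \<in> E})"
    proof (rule distinct_representatives)
      fix i assume i: "i < length xs"
      have "card (f ` {w \<in> U. {xs ! i, w} \<in> E}) \<le> card {w \<in> U. {xs ! i, w} \<in> E}"
        using U(1) by (intro card_image_le) simp
      then show "finite (f ` {w \<in> U. {xs ! i, w} \<in> E}) \<and>
          card (f ` {w \<in> U. {xs ! i, w} \<in> E}) + i < length xs"
        using few[OF i] U(1) by simp
    qed (use R finR xs in auto)
    then obtain g where g: "inj_on g (set xs)" "g ` set xs \<subseteq> R"
      "\<And>x w. x \<in> set xs \<Longrightarrow> w \<in> U \<Longrightarrow> {x, w} \<in> E \<Longrightarrow> g x \<noteq> f w"
      by blast
    \<comment> \<open>As \<open>R\<close> has exactly as many colours as there are new vertices,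
      each class in \<open>R\<close> grows by exactly one.\<close>
    have gR: "g ` set xs = R"
      using g(1,2) R(2) xs(1) finR by (metis card_image card_subset_eq distinct_card)
    define h where "h = (\<lambda>v. if v \<in> set xs then g v else f v)"
    have hU: "h v = f v" if "v \<in> U" for v using that xs(2) by (auto simp: h_def)
    have hx: "h v = g v" if "v \<in> set xs" for v using that by (simp add: h_def)
    have "proper_coloring (U \<union> set xs) E n h"
      unfolding proper_coloring_def
    proof (intro conjI ballI impI)
      fix v assume "v \<in> U \<union> set xs"
      then show "h v < n"
      proof
        assume "v \<in> set xs"
        then show ?thesis using g(2) R(1) by (force simp: hx)
      qed (use f in \<open>auto simp: hU equitable_coloring_def proper_coloring_def\<close>)
    next
      fix u v assume uv: "u \<in> U \<union> set xs" "v \<in> U \<union> set xs" "{u, v} \<in> E"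
      then have "u \<noteq> v" using loopless by auto
      moreover have "{v, u} \<in> E" using uv by (simp add: insert_commute)
      moreover have "f u \<noteq> f v" if "u \<in> U" "v \<in> U"
        using f that uv(3) by (simp add: equitable_coloring_def proper_coloring_def)
      ultimately show "h u \<noteq> h v"
        using uv inj_onD[OF g(1), of u v] g(3)[of u v] g(3)[of v u]
        by (cases "u \<in> set xs"; cases "v \<in> set xs") (auto simp: hU hx)
    qed
    moreover have size: "card (color_class (U \<union> set xs) h i) = c i + (if i \<in> R then 1 else 0)" for i
    proof -
      have "color_class (U \<union> set xs) h i = color_class U f i \<union> {v \<in> set xs. g v = i}"
        by (auto simp: color_class_def hU hx)
      moreover have "color_class U f i \<inter> {v \<in> set xs. g v = i} = {}"
        using xs(2) by (auto simp: color_class_def)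
      ultimately have "card (color_class (U \<union> set xs) h i) = c i + card {v \<in> set xs. g v = i}"
        unfolding c_def using U(1) by (simp add: card_Un_disjoint color_class_def)
      moreover have "card {v \<in> set xs. g v = i} = (if i \<in> R then 1 else 0)"
      proof (cases "i \<in> R")
        case True
        then obtain x where x: "x \<in> set xs" "g x = i" using gR by auto
        then have "{v \<in> set xs. g v = i} = {x}" using g(1) by (auto simp: inj_on_def)
        then show ?thesis using True by simp
      next
        case False
        then have "{v \<in> set xs. g v = i} = {}" using gR by auto
        then show ?thesis using False by (metis card.empty)
      qed
      ultimately show ?thesis by simp
    qed
    have "card (color_class (U \<union> set xs) h j) \<le> card (color_class (U \<union> set xs) h i) + 1"
      if "i < n" "j < n" for i j
      using R(3) le[OF that(1)] le[OF that(2)] ge[OF that(1)] ge[OF that(2)] that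
      unfolding size A_def by force
    ultimately show ?thesis
      by (auto simp: equitably_colorable_def equitable_coloring_def)
  qed
qed

section \<open>Non-backtracking walks\<close>

text \<open>Only immediate reversals are forbidden, so a concrete walk is checked locally; for short
  walks the girth then supplies distinctness.\<close>

fun nbwalk :: "'a set set \<Rightarrow> 'a list \<Rightarrow> bool" where
  "nbwalk E (u # v # w # p) \<longleftrightarrow> {u, v} \<in> E \<and> u \<noteq> w \<and> nbwalk E (v # w # p)"
| "nbwalk E [u, v] \<longleftrightarrow> {u, v} \<in> E"
| "nbwalk E [u] \<longleftrightarrow> True"
| "nbwalk E [] \<longleftrightarrow> True"

lemma nbwalk_ConsD: "nbwalk E (u # p) \<Longrightarrow> nbwalk E p"
  by (cases "(E, u # p)" rule: nbwalk.cases) auto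

lemma nbwalk_appendD: "nbwalk E (p @ q) \<Longrightarrow> nbwalk E p \<and> nbwalk E q"
proof (induction E p rule: nbwalk.induct)
  case (2 E u v)
  then show ?case by (cases q) (auto dest: nbwalk_ConsD)
next
  case (3 E u)
  then show ?case by (auto dest: nbwalk_ConsD)
qed auto

lemma nbwalk_snoc:
  "nbwalk E (p @ [u, v]) \<Longrightarrow> {v, w} \<in> E \<Longrightarrow> u \<noteq> w \<Longrightarrow> nbwalk E (p @ [u, v, w])"
  by (induction E p rule: nbwalk.induct) auto

lemma nbwalk_nth: "nbwalk E p \<Longrightarrow> Suc i < length p \<Longrightarrow> {p ! i, p ! Suc i} \<in> E"
proof (induction E p arbitrary: i rule: nbwalk.induct)
  case (1 E u v w p)
  then show ?case by (cases i) auto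
qed auto

lemma nbwalk_rev: "nbwalk E p \<Longrightarrow> nbwalk E (rev p)"
proof (induction E p rule: nbwalk.induct)
  case (1 E u v w p)
  then show ?case using nbwalk_snoc[of E "rev p" w v u] by (auto simp: insert_commute)
qed (auto simp: insert_commute)

lemma nbwalk_glue:
  "nbwalk E (p @ [v, u]) \<Longrightarrow> nbwalk E (u # w # q) \<Longrightarrow> v \<noteq> w \<Longrightarrow> nbwalk E (p @ v # u # w # q)"
  by (induction E p rule: nbwalk.induct) auto

text \<open>The first return to the starting vertex would close a cycle of at most nine edges. It
  has at least three, since there are no loops and no reversals.\<close>

lemma nbwalk_distinct:
  assumes E: "\<And>e. e \<in> E \<Longrightarrow> e \<subseteq> V \<and> card e = 2" and girth: "10 \<le> girth V E"
    and "nbwalk E p" and "length p \<le> 10"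
  shows "distinct p"
  using assms(3,4)
proof (induction p)
  case (Cons u p)
  have nb: "nbwalk E p" using nbwalk_ConsD[OF Cons.prems(1)] .
  then have dp: "distinct p" using Cons.IH Cons.prems(2) by simp
  have "u \<notin> set p"
  proof
    assume "u \<in> set p"
    then obtain q r where p: "p = q @ u # r" "u \<notin> set q" by (meson split_list_first)
    have nb1: "nbwalk E (u # q @ [u])"
      using nbwalk_appendD[of E "u # q @ [u]" r] Cons.prems p by simp
    have len: "length (u # q) \<ge> 3"
    proof (rule ccontr)
      assume "\<not> ?thesis"
      then have "q = [] \<or> (\<exists>v. q = [v])" by (cases q; cases "tl q") auto
      then show False using nb1 E[of "{u}"] by auto
    qed
    have step: "{(u # q) ! i, (u # q) ! (Suc i mod length (u # q))} \<in> E" if i: "i < length (u # q)" for i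
    proof (cases "Suc i < length (u # q)")
      case True
      then show ?thesis using nbwalk_nth[OF nb1, of i]
        by (auto simp: nth_append nth_Cons split: nat.splits if_splits)
    next
      case False
      then have "Suc i = length (u # q)" using i by simp
      then show ?thesis using nbwalk_nth[OF nb1, of i]
        by (auto simp: nth_append nth_Cons split: nat.splits if_splits)
    qed
    have "set (u # q) \<subseteq> V"
    proof
      fix x assume "x \<in> set (u # q)"
      then obtain i where "i < length (u # q)" "x = (u # q) ! i" by (metis in_set_conv_nth)
      then show "x \<in> V" using E[OF step[of i]] by auto
    qed
    then have "is_cycle V E (u # q)"
      unfolding is_cycle_def using step len p dp by auto
    then have "girth V E \<le> enat (length (u # q))"
      unfolding girth_def by (intro INF_lower) simp
    then have "enat 10 \<le> enat (length (u # q))"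
      using girth order_trans by (metis numeral_eq_enat)
    then show False using Cons.prems p by simp
  qed
  then show ?case using dp by simp
qed simp

text \<open>Strip the common beginning; at the point of divergence the reverse of one walk continues
  into the other without reversal. The result has at most ten vertices, hence is distinct, although
  its two ends agree.\<close>

lemma nbwalk_unique:
  assumes E: "\<And>e. e \<in> E \<Longrightarrow> e \<subseteq> V \<and> card e = 2" and girth: "10 \<le> girth V E"
    and "nbwalk E (z # p)" "nbwalk E (z # q)" "last (z # p) = last (z # q)"
    and "length p + length q \<le> 9"
  shows "p = q"
  using assms(3-)
proof (induction p arbitrary: z q)
  case Nil
  then show ?case
    using nbwalk_distinct[OF E girth, of "z # q"] by (cases q) (auto split: if_splits)
next
  case (Cons x p)
  show ?case
  proof (cases q)
    case Nil
    then show ?thesis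
      using nbwalk_distinct[OF E girth, of "z # x # p"] Cons.prems by (auto split: if_splits)
  next
    case (Cons y q')
    show ?thesis
    proof (cases "x = y")
      case True
      then show ?thesis
        using Cons.IH[of y q'] Cons.prems nbwalk_ConsD[of E z] \<open>q = y # q'\<close> by auto
    next
      case False
      have "nbwalk E (rev p @ [x, z])"
        using nbwalk_rev[OF Cons.prems(1)] by simp
      then have "nbwalk E (rev p @ x # z # y # q')"
        using nbwalk_glue[of E "rev p" x z y q'] Cons.prems(2) \<open>q = y # q'\<close> False by simp
      then have "distinct (rev p @ x # z # y # q')"
        using nbwalk_distinct[OF E girth, of "rev p @ x # z # y # q'"] Cons.prems(4) \<open>q = y # q'\<close>
        by simp
      moreover have "last (x # p) = last (y # q')" using Cons.prems \<open>q = y # q'\<close> by simp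
      ultimately show ?thesis
        by (cases p rule: rev_cases; cases q' rule: rev_cases) auto
    qed
  qed
qed

section \<open>A minimal counterexample and its partial colourings\<close>

text \<open>All subgraphs are induced on vertex sets while \<open>V\<close> and \<open>E\<close>
  stay fixed, so the girth assumption on the whole graph serves every one of them. Minimality
  compares only with sets that again have minimum degree two.\<close>

locale minimal_counterexample =
  fixes V :: "'a set" and E :: "'a set set" and n :: nat and U :: "'a set"
  assumes graph: "simple_graph V E"
    and girth: "10 \<le> girth V E"
    and n: "4 \<le> n"
    and U: "U \<subseteq> V"
    and min_deg: "\<And>v. v \<in> U \<Longrightarrow> 2 \<le> card {w \<in> U. {v, w} \<in> E}"
    and not_colorable: "\<not> equitably_colorable U E n"
    and smaller: "\<And>W. W \<subset> U \<Longrightarrow> (\<And>v. v \<in> W \<Longrightarrow> 2 \<le> card {w \<in> W. {v, w} \<in> E}) \<Longrightarrow>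
      equitably_colorable W E n"
begin

definition N :: "'a \<Rightarrow> 'a set" where "N v = {w \<in> U. {v, w} \<in> E}"

abbreviation d :: "'a \<Rightarrow> nat" where "d v \<equiv> card (N v)"

text \<open>\<open>L\<close> holds the vertices still uncoloured. Each reduction starts with
  \<open>co S\<close> for a deleted set \<open>S\<close> and shrinks the set group by group to the
  contradictory \<open>co {}\<close>.\<close>

definition co :: "'a set \<Rightarrow> bool" where "co L \<longleftrightarrow> equitably_colorable (U - L) E n"

lemma edge: "e \<in> E \<Longrightarrow> e \<subseteq> V \<and> card e = 2"
  using graph by (auto simp: simple_graph_def)

lemma finite_U [simp]: "finite U"
  using graph U finite_subset by (auto simp: simple_graph_def)

lemma finite_N [simp]: "finite (N v)"
  by (simp add: N_def)

lemma N_subset: "N v \<subseteq> U"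
  by (auto simp: N_def)

lemma loopless: "{v} \<notin> E"
  using edge by fastforce

lemma notin_N: "v \<notin> N v"
  by (simp add: N_def loopless)

lemma N_sym: "v \<in> U \<Longrightarrow> w \<in> N v \<Longrightarrow> v \<in> N w"
  by (simp add: N_def insert_commute)

lemma N_edge: "w \<in> N v \<Longrightarrow> {v, w} \<in> E"
  by (simp add: N_def)

lemma d_ge2: "v \<in> U \<Longrightarrow> 2 \<le> d v"
  using min_deg by (simp add: N_def)

lemma not_co_empty: "\<not> co {}"
  using not_colorable by (simp add: co_def)

lemma co_start:
  assumes "S \<subseteq> U" "S \<noteq> {}" "\<And>u. u \<in> U - S \<Longrightarrow> 2 \<le> card (N u - S)"
  shows "co S"
  unfolding co_def
proof (rule smaller)
  show "U - S \<subset> U" using assms by auto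
  fix v assume v: "v \<in> U - S"
  have "{w \<in> U - S. {v, w} \<in> E} = N v - S" by (auto simp: N_def)
  then show "2 \<le> card {w \<in> U - S. {v, w} \<in> E}" using assms(3)[OF v] by simp
qed

lemma co_ext:
  assumes "co L" "L \<subseteq> U" "distinct xs" "set xs \<subseteq> L" "length xs \<le> 4"
    and "\<And>i. i < length xs \<Longrightarrow> card (N (xs ! i) - L) + i < length xs"
    and "L' = L - set xs"
  shows "co L'"
proof -
  have "equitably_colorable ((U - L) \<union> set xs) E n"
  proof (rule equitable_extend)
    fix i assume i: "i < length xs"
    have "{w \<in> U - L. {xs ! i, w} \<in> E} = N (xs ! i) - L" by (auto simp: N_def)
    then show "card {w \<in> U - L. {xs ! i, w} \<in> E} + i < length xs" using assms(6)[OF i] by simp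
  qed (use assms n loopless in \<open>auto simp: co_def\<close>)
  moreover have "(U - L) \<union> set xs = U - L'" using assms by auto
  ultimately show ?thesis by (simp add: co_def)
qed

lemma card_le_length: "A \<subseteq> set ys \<Longrightarrow> card A \<le> length ys"
  by (meson List.finite_set card_length card_mono le_trans)

text \<open>\<open>co_ext1\<close> to \<open>co_ext4\<close> treat groups of one to four vertices.
  Vertices that may already be coloured are passed by name, and a name may be repeated when fewer of
  them can occur.\<close>

lemma co_ext1:
  assumes "co L" "L \<subseteq> U" "x \<in> L" "N x \<subseteq> L" "L' = L - {x}"
  shows "co L'"
proof (rule co_ext[of L "[x]"])
  show "card (N ([x] ! i) - L) + i < length [x]" if "i < length [x]" for i
    using that assms(4) card_le_length[of "N x - L" "[]"] by auto
qed (use assms in auto)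

lemma co_ext2:
  assumes "co L" "L \<subseteq> U" "{x, y} \<subseteq> L" "x \<noteq> y" "N x - L \<subseteq> {p}" "N y \<subseteq> L" "L' = L - {x, y}"
  shows "co L'"
proof (rule co_ext[of L "[x, y]"])
  define cx where "cx = card (N x - L)"
  have cx: "cx \<le> 1"
    unfolding cx_def using card_le_length[of "N x - L" "[p]"] assms by simp
  define cy where "cy = card (N y - L)"
  have cy: "cy \<le> 0"
    unfolding cy_def using card_le_length[of "N y - L" "[]"] assms by simp
  show "card (N ([x, y] ! i) - L) + i < length [x, y]" if "i < length [x, y]" for i
  proof -
    have "i = 0 \<or> i = 1" using that by auto
    then show ?thesis
      using cx cy by (elim disjE) (simp_all flip: cx_def cy_def)
  qed
qed (use assms in auto)

lemma co_ext3:
  assumes "co L" "L \<subseteq> U" "{x, y, z} \<subseteq> L" "distinct [x, y, z]"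
    and "N x - L \<subseteq> {p, q}" "N y - L \<subseteq> {r}" "N z \<subseteq> L" "L' = L - {x, y, z}"
  shows "co L'"
proof (rule co_ext[of L "[x, y, z]"])
  define cx where "cx = card (N x - L)"
  have cx: "cx \<le> 2"
    unfolding cx_def using card_le_length[of "N x - L" "[p, q]"] assms by simp
  define cy where "cy = card (N y - L)"
  have cy: "cy \<le> 1"
    unfolding cy_def using card_le_length[of "N y - L" "[r]"] assms by simp
  define cz where "cz = card (N z - L)"
  have cz: "cz \<le> 0"
    unfolding cz_def using card_le_length[of "N z - L" "[]"] assms by simp
  show "card (N ([x, y, z] ! i) - L) + i < length [x, y, z]" if "i < length [x, y, z]" for i
  proof -
    have "i = 0 \<or> i = 1 \<or> i = 2" using that by auto
    then show ?thesis
      using cx cy cz by (elim disjE) (simp_all flip: cx_def cy_def cz_def)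
  qed
qed (use assms in auto)

lemma co_ext4:
  assumes "co L" "L \<subseteq> U" "{x, y, z, t} \<subseteq> L" "distinct [x, y, z, t]"
    and "N x - L \<subseteq> {p, q, p'}" "N y - L \<subseteq> {r, r'}" "N z - L \<subseteq> {s}" "N t \<subseteq> L"
    and "L' = L - {x, y, z, t}"
  shows "co L'"
proof (rule co_ext[of L "[x, y, z, t]"])
  define cx where "cx = card (N x - L)"
  have cx: "cx \<le> 3"
    unfolding cx_def using card_le_length[of "N x - L" "[p, q, p']"] assms by simp
  define cy where "cy = card (N y - L)"
  have cy: "cy \<le> 2"
    unfolding cy_def using card_le_length[of "N y - L" "[r, r']"] assms by simp
  define cz where "cz = card (N z - L)"
  have cz: "cz \<le> 1"
    unfolding cz_def using card_le_length[of "N z - L" "[s]"] assms by simp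
  define ct where "ct = card (N t - L)"
  have ct: "ct \<le> 0"
    unfolding ct_def using card_le_length[of "N t - L" "[]"] assms by simp
  show "card (N ([x, y, z, t] ! i) - L) + i < length [x, y, z, t]" if "i < length [x, y, z, t]" for i
  proof -
    have "i = 0 \<or> i = 1 \<or> i = 2 \<or> i = 3" using that by auto
    then show ?thesis
      using cx cy cz ct by (elim disjE) (simp_all flip: cx_def cy_def cz_def ct_def)
  qed
qed (use assms in auto)

section \<open>Threads\<close>

text \<open>If the list is removed from its front, then every vertex but the first has at most one neighbour
  left when its turn comes, namely its successor in the list.\<close>

definition tail :: "'a list \<Rightarrow> bool" where
  "tail t \<longleftrightarrow> distinct t \<and> set t \<subseteq> U \<and> (0 < length t \<longrightarrow> d (t ! 0) \<le> 2) \<and>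
     (\<forall>i. Suc i < length t \<longrightarrow> t ! Suc i \<in> N (t ! i) \<and>
        card (N (t ! Suc i) - set (take (Suc i) t)) \<le> 1)"

text \<open>The successor is not among the removed vertices, so it is the single neighbour left.
  Thus a vertex of the list other than its first and last one has no neighbour outside the
  list.\<close>

lemma tail_next:
  assumes "tail t" "0 < i" "Suc i < length t"
  shows "N (t ! i) \<subseteq> insert (t ! Suc i) (set (take i t))"
proof -
  obtain j where j: "i = Suc j" using assms(2) by (cases i) auto
  have "t ! Suc i \<notin> set (take i t)"
    using assms by (auto simp: tail_def in_set_conv_nth nth_eq_iff_index_eq)
  then have "t ! Suc i \<in> N (t ! i) - set (take i t)" using assms by (auto simp: tail_def)
  moreover have "card (N (t ! i) - set (take i t)) \<le> 1" using assms j by (auto simp: tail_def)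
  ultimately show ?thesis
    using card_le_Suc0_iff_eq[of "N (t ! i) - set (take i t)"] by auto
qed

text \<open>Colour from the far end in pairs: the last vertex sees at most one colour, the one
  before it none. The pairs must stop at three or four vertices, because \<open>t ! 0\<close> may
  itself have a coloured neighbour; in the final group the last vertex comes first, then
  \<open>t ! 0\<close>, then the inner vertices.\<close>

lemma co_tail:
  assumes "tail t" "3 \<le> k" "k \<le> length t" "co (set (take k t))"
  shows "co {}"
  using assms(2-)
proof (induction k rule: less_induct)
  case (less k)
  define L where "L = set (take k t)"
  have nth_L: "t ! i \<in> L" if "i < k" for i
    using that less.prems by (auto simp: L_def in_set_conv_nth intro!: exI[of _ i])
  have LU: "L \<subseteq> U" using assms(1) set_take_subset[of k t] by (auto simp: L_def tail_def)
  have neq: "t ! i \<noteq> t ! j" if "i < k" "j < k" "i \<noteq> j" for i j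
    using that less.prems assms(1) by (auto simp: tail_def nth_eq_iff_index_eq)
  have inner: "N (t ! i) \<subseteq> L" if "0 < i" "Suc i < k" for i
  proof -
    have "N (t ! i) \<subseteq> insert (t ! Suc i) (set (take i t))"
      using tail_next[OF assms(1), of i] that less.prems by auto
    moreover have "set (take i t) \<subseteq> L"
      unfolding L_def by (rule set_take_subset_set_take) (use that in simp)
    ultimately show ?thesis using nth_L[OF that(2)] by auto
  qed
  have one: "\<exists>p. A \<subseteq> {p}" if "card A \<le> 1" "finite A" for A :: "'a set"
  proof -
    have "\<forall>x\<in>A. \<forall>y\<in>A. x = y" using that card_le_Suc0_iff_eq[of A] by simp
    then show ?thesis by blast
  qed
  have "\<exists>p. N (t ! (k - 1)) - L \<subseteq> {p}"
  proof (rule one)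
    have k: "k - 1 = Suc (k - 2)" using less.prems by simp
    have "card (N (t ! (k - 1)) - L) \<le> card (N (t ! Suc (k - 2)) - set (take (Suc (k - 2)) t))"
      unfolding k[symmetric] L_def
      using set_take_subset_set_take[of "k - 1" k t] by (intro card_mono) auto
    also have "\<dots> \<le> 1" using assms(1) less.prems by (auto simp: tail_def)
    finally show "card (N (t ! (k - 1)) - L) \<le> 1" .
  qed simp
  then obtain p where p: "N (t ! (k - 1)) - L \<subseteq> {p}" by blast
  have "\<exists>p. N (t ! 0) - L \<subseteq> {p}"
  proof (rule one)
    have "t ! 1 \<in> N (t ! 0)" "d (t ! 0) \<le> 2" using assms(1) less.prems by (auto simp: tail_def)
    moreover have "N (t ! 0) - L \<subseteq> N (t ! 0) - {t ! 1}" using nth_L[of 1] less.prems by auto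
    then have "card (N (t ! 0) - L) \<le> card (N (t ! 0) - {t ! 1})" by (intro card_mono) auto
    ultimately show "card (N (t ! 0) - L) \<le> 1" by simp
  qed simp
  then obtain q where q: "N (t ! 0) - L \<subseteq> {q}" by blast
  have coL: "co L" using less.prems by (simp add: L_def)
  consider "k = 3" | "k = 4" | "k \<ge> 5" using less.prems by linarith
  then show ?case
  proof cases
    case 1
    have "{0..<3::nat} = {2, 0, 1}" by auto
    then have "L = {t ! 2, t ! 0, t ! 1}"
      using 1 less.prems nth_image[of k t] by (simp add: L_def)
    moreover have "distinct [t ! 2, t ! 0, t ! 1]"
      using neq[of 0 1] neq[of 0 2] neq[of 1 2] 1 by simp
    ultimately show ?thesis
      using p q inner[of 1] 1 by (intro co_ext3[OF coL LU, of "t ! 2" "t ! 0" "t ! 1" p p q]) simp_all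
  next
    case 2
    have "{0..<4::nat} = {3, 0, 1, 2}" by auto
    then have "L = {t ! 3, t ! 0, t ! 1, t ! 2}"
      using 2 less.prems nth_image[of k t] by (simp add: L_def)
    moreover have "distinct [t ! 3, t ! 0, t ! 1, t ! 2]"
      using neq[of 0 1] neq[of 0 2] neq[of 0 3] neq[of 1 2] neq[of 1 3] neq[of 2 3] 2 by simp
    moreover have "N (t ! 1) - L \<subseteq> {q}" using inner[of 1] 2 by auto
    ultimately show ?thesis
      using p q inner[of 2] 2
      by (intro co_ext4[OF coL LU, of "t ! 3" "t ! 0" "t ! 1" "t ! 2" p p p q q q]) simp_all
  next
    case 3
    have "take k t = take (k - 2) t @ [t ! (k - 2), t ! (k - 1)]"
      using 3 less.prems take_Suc_conv_app_nth[of "k - 2" t] take_Suc_conv_app_nth[of "k - 1" t]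
      by (simp add: Suc_diff_Suc numeral_2_eq_2)
    moreover have "distinct (take k t)" using assms(1) by (simp add: tail_def)
    ultimately have "set (take (k - 2) t) = L - {t ! (k - 1), t ! (k - 2)}"
      unfolding L_def by auto
    then have "co (set (take (k - 2) t))"
      using neq[of "k - 1" "k - 2"] nth_L[of "k - 1"] nth_L[of "k - 2"] p inner[of "k - 2"] 3
      by (intro co_ext2[OF coL LU, of "t ! (k - 1)" "t ! (k - 2)" p]) simp_all
    then show ?thesis using less.IH[of "k - 2"] 3 less.prems by simp
  qed
qed

lemma longest_list:
  assumes "P xs" "\<And>xs. P xs \<Longrightarrow> distinct xs \<and> set xs \<subseteq> U"
  shows "\<exists>ys. P ys \<and> (\<forall>zs. P zs \<longrightarrow> length zs \<le> length ys)"
proof (rule ex_has_greatest_nat[of P xs length "Suc (card U)"])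
  show "P xs" by fact
  show "\<forall>zs. P zs \<longrightarrow> length zs < Suc (card U)"
    using assms(2) by (metis card_mono distinct_card finite_U less_Suc_eq_le)
qed

text \<open>Start with a longest path of vertices of degree two, and prolong it at one end as long as only
  one continuation is left; this covers threads between two branch vertices, threads closing up at a
  branch vertex, and components that are cycles.\<close>

lemma no_long_thread:
  assumes "x \<in> N y" "z \<in> N y" "x \<noteq> z" "y \<in> U" "d x = 2" "d y = 2" "d z = 2"
  shows False
proof -
  define P where "P = (\<lambda>p. distinct p \<and> set p \<subseteq> U \<and> (\<forall>v\<in>set p. d v = 2) \<and>
    (\<forall>i. Suc i < length p \<longrightarrow> p ! Suc i \<in> N (p ! i)))"
  have "P [x, y, z]"
    using assms N_subset notin_N N_sym by (auto simp: P_def less_Suc_eq nth_Cons split: nat.splits)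
  then have "\<exists>p. P p \<and> (\<forall>p'. P p' \<longrightarrow> length p' \<le> length p)"
    by (rule longest_list) (simp add: P_def)
  then obtain p where p: "P p" "\<And>p'. P p' \<Longrightarrow> length p' \<le> length p" by blast
  have p3: "3 \<le> length p" using p(2)[OF \<open>P [x, y, z]\<close>] by simp
  have tail_p: "tail p"
    unfolding tail_def
  proof (intro conjI allI impI)
    fix i assume i: "Suc i < length p"
    then have "p ! i \<in> N (p ! Suc i)"
      using p(1) N_sym[of "p ! i" "p ! Suc i"] subsetD[of "set p" U "p ! i"] by (auto simp: P_def)
    moreover have "p ! i \<in> set (take (Suc i) p)"
      using i by (auto simp: in_set_conv_nth intro!: exI[of _ i])
    ultimately have "card (N (p ! Suc i) - set (take (Suc i) p)) \<le> card (N (p ! Suc i) - {p ! i})"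
      by (intro card_mono) auto
    also have "\<dots> = 1" using \<open>p ! i \<in> N (p ! Suc i)\<close> p(1) i by (simp add: P_def)
    finally show "card (N (p ! Suc i) - set (take (Suc i) p)) \<le> 1" .
  qed (use p(1) in \<open>auto simp: P_def\<close>)
  \<comment> \<open>Only the rear of the path grows; its front stays \<open>p ! 0\<close>, where the
    maximality of \<open>p\<close> controls what can be attached.\<close>
  define T where "T = (\<lambda>t. tail t \<and> (\<exists>r. t = p @ r))"
  have "T p" using tail_p by (simp add: T_def)
  then have "\<exists>t. T t \<and> (\<forall>t'. T t' \<longrightarrow> length t' \<le> length t)"
    by (rule longest_list) (simp add: T_def tail_def)
  then obtain t where t: "T t" "\<And>t'. T t' \<Longrightarrow> length t' \<le> length t" by blast
  have tl: "tail t" and pt: "set p \<subseteq> set t" and lt: "length p \<le> length t" and t0: "t ! 0 = p ! 0"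
    using t(1) p3 by (auto simp: T_def nth_append)
  have nemp: "t \<noteq> []" using p3 lt by auto
  have "co (set t)"
  proof (rule co_start)
    show "set t \<subseteq> U" "set t \<noteq> {}" using tl nemp by (auto simp: tail_def)
    fix u assume u: "u \<in> U - set t"
    show "2 \<le> card (N u - set t)"
    proof (cases "last t \<in> N u")
      case True
      \<comment> \<open>If at most one neighbour of \<open>u\<close> were left, then
        \<open>u\<close> would prolong the tail, against its maximality.\<close>
      have "\<not> T (t @ [u])" using t(2)[of "t @ [u]"] by auto
      then have "\<not> tail (t @ [u])" using t(1) by (auto simp: T_def)
      moreover have "u \<in> N (last t)" using N_sym True u by auto
      moreover have "tail (t @ [u])" if le: "card (N u - set t) \<le> 1"
      proof -
        have "(t @ [u]) ! Suc i \<in> N ((t @ [u]) ! i) \<and>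
            card (N ((t @ [u]) ! Suc i) - set (take (Suc i) (t @ [u]))) \<le> 1"
          if i: "Suc i < length (t @ [u])" for i
        proof (cases "Suc i < length t")
          case True
          then show ?thesis using tl by (auto simp: tail_def nth_append)
        next
          case False
          then have "Suc i = length t" using i by simp
          moreover from this have "t ! i = last t" using nemp by (metis diff_Suc_1 last_conv_nth)
          ultimately show ?thesis using le \<open>u \<in> N (last t)\<close> by (auto simp: nth_append)
        qed
        moreover have "distinct (t @ [u])" "set (t @ [u]) \<subseteq> U" "d ((t @ [u]) ! 0) \<le> 2"
          using tl u nemp by (auto simp: tail_def nth_append)
        ultimately show ?thesis unfolding tail_def by blast
      qed
      ultimately have "\<not> card (N u - set t) \<le> 1" by blast
      then show ?thesis by simp
    next
      case False
      \<comment> \<open>A vertex outside that misses the end of \<open>t\<close> can only see its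
        front, because the other vertices have all their neighbours in \<open>t\<close>.\<close>
      have only: "N u \<inter> set t \<subseteq> {t ! 0}"
      proof
        fix v assume v: "v \<in> N u \<inter> set t"
        then obtain i where i: "i < length t" "v = t ! i" by (metis Int_iff in_set_conv_nth)
        have "Suc i \<noteq> length t" using False v i nemp by (metis IntD1 diff_Suc_1 last_conv_nth)
        then have "Suc i < length t" using i by simp
        moreover have "u \<in> N v" using v u N_sym by auto
        ultimately have "\<not> 0 < i"
          using tail_next[OF tl, of i] i u set_take_subset[of i t] nth_mem[of "Suc i" t] by blast
        then show "v \<in> {t ! 0}" using i by simp
      qed
      show ?thesis
      proof (cases "N u \<inter> set t = {}")
        case True
        then have "N u - set t = N u" by auto
        then show ?thesis using d_ge2 u by simp
      next
        case False
        then have t0u: "t ! 0 \<in> N u" using only by auto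
        \<comment> \<open>Otherwise \<open>u # p\<close> would be a longer path of vertices of
          degree two. So \<open>u\<close> is a branch vertex and loses just one neighbour.\<close>
        have "d u \<noteq> 2"
        proof
          assume "d u = 2"
          then have "P (u # p)"
            using p(1) u pt t0u N_sym[of u "t ! 0"] t0
            by (auto simp: P_def nth_Cons split: nat.splits)
          then show False using p(2) by fastforce
        qed
        then have "3 \<le> d u" using d_ge2[of u] u by auto
        moreover have "N u - set t = N u - {t ! 0}" using only nemp by auto
        ultimately show ?thesis using t0u by simp
      qed
    qed
  qed
  then show False using co_tail[OF tl, of "length t"] lt p3 not_co_empty by simp
qed


section \<open>Legs of a branch vertex\<close>

lemma walk_unique:
  assumes "nbwalk E (z # p)" "nbwalk E (z # q)" "last (z # p) = last (z # q)" "length p + length q \<le> 9"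
  shows "p = q"
  using nbwalk_unique[of E V z p q] edge girth assms by blast

text \<open>A thread is viewed from its end \<open>z\<close> and named by its first inner vertex
  \<open>x\<close>. Only the far end is required to be a branch vertex, so \<open>two_leg\<close>
  can also be used while the degree of \<open>z\<close> is still unknown.\<close>

definition one_leg :: "'a \<Rightarrow> 'a \<Rightarrow> bool" where
  "one_leg z x \<longleftrightarrow> (\<exists>y. N x = {z, y} \<and> z \<noteq> y \<and> 3 \<le> d y)"

definition two_leg :: "'a \<Rightarrow> 'a \<Rightarrow> bool" where
  "two_leg z x \<longleftrightarrow> (\<exists>x' y. N x = {z, x'} \<and> z \<noteq> x' \<and> N x' = {x, y} \<and> x \<noteq> y \<and> 3 \<le> d y)"

definition poor :: "'a \<Rightarrow> bool" where
  "poor v \<longleftrightarrow> v \<in> U \<and>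
    (\<exists>a b c. N v = {a, b, c} \<and> distinct [a, b, c] \<and> two_leg v a \<and> one_leg v b \<and> one_leg v c)"

text \<open>\<open>Q\<close> is a set of vertices behind the neighbour \<open>x\<close> of \<open>z\<close> that is to be deleted together with
  \<open>z\<close>; \<open>D\<close> contains those that are four steps away from \<open>z\<close>. An empty \<open>Q\<close> is allowed if \<open>x\<close> is itself
  a branch vertex.\<close>

definition leg :: "'a \<Rightarrow> 'a \<Rightarrow> 'a set \<Rightarrow> 'a set \<Rightarrow> bool" where
  "leg z x Q D \<longleftrightarrow> Q \<subseteq> U \<and> (x \<in> Q \<or> 3 \<le> d x) \<and>
    (\<forall>q\<in>Q. \<exists>p. nbwalk E (z # x # p) \<and> last (x # p) = q \<and> set (x # p) \<subseteq> Q \<and>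
      (length p \<le> 2 \<or> length p = 3 \<and> q \<in> D)) \<and>
    (\<forall>q\<in>Q. \<forall>u\<in>N q. u \<in> insert z Q \<or> 3 \<le> d u) \<and>
    (\<forall>q\<in>D. \<forall>u\<in>N q. u \<in> insert z Q \<or> two_leg u q)"

lemma leg_walk:
  assumes "leg z x Q D" "q \<in> Q"
  obtains p where "nbwalk E (z # x # p)" "last (x # p) = q" "set (x # p) \<subseteq> Q"
    "length p \<le> 2 \<or> length p = 3 \<and> q \<in> D"
  using assms unfolding leg_def by blast

lemma leg_walk_le:
  assumes "leg z x Q D" "q \<in> Q"
  obtains p where "nbwalk E (z # x # p)" "last (x # p) = q" "length p \<le> 3"
proof -
  obtain p where p: "nbwalk E (z # x # p)" "last (x # p) = q"
    "length p \<le> 2 \<or> length p = 3 \<and> q \<in> D"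
    using leg_walk[OF assms] .
  show ?thesis by (rule that[OF p(1,2)]) (use p(3) in auto)
qed

lemma leg_root: "leg z x Q D \<Longrightarrow> z \<notin> Q"
proof
  assume *: "leg z x Q D" "z \<in> Q"
  obtain p where "nbwalk E (z # x # p)" "last (x # p) = z" "length p \<le> 3"
    using leg_walk_le[OF *] .
  then show False using walk_unique[of z "x # p" "[]"] by simp
qed

text \<open>Every vertex of a leg is reached from \<open>z\<close> by at most four edges. A shared
  vertex would be the end of two walks with different first steps and at most eight edges
  together.\<close>

lemma leg_disjoint:
  assumes "leg z x Q D" "leg z x' Q' D'" "x \<noteq> x'"
  shows "Q \<inter> Q' = {}"
proof (rule ccontr)
  assume "\<not> ?thesis"
  then obtain q where q: "q \<in> Q" "q \<in> Q'" by auto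
  obtain p where p: "nbwalk E (z # x # p)" "last (x # p) = q" "length p \<le> 3"
    using leg_walk_le[OF assms(1) q(1)] .
  obtain p' where p': "nbwalk E (z # x' # p')" "last (x' # p') = q" "length p' \<le> 3"
    using leg_walk_le[OF assms(2) q(2)] .
  show False using walk_unique[of z "x # p" "x' # p'"] p p' assms(3) by auto
qed

text \<open>The new vertex lies outside a set containing the whole walk, so the last step is not a
  reversal.\<close>

lemma nbwalk_leave:
  assumes p: "nbwalk E (z # p)" "set (z # p) \<subseteq> S" and u: "u \<in> N (last (z # p))" "u \<notin> S"
  shows "nbwalk E (z # p @ [u])"
proof (cases p rule: rev_cases)
  case Nil
  then show ?thesis using u by (simp add: N_edge)
next
  case (snoc p' y)
  show ?thesis
  proof (cases p' rule: rev_cases)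
    case Nil
    then show ?thesis using p u snoc nbwalk_snoc[of E "[]" z y u] by (auto simp: N_edge)
  next
    case (snoc p'' w)
    then show ?thesis
      using p u \<open>p = p' @ [y]\<close> nbwalk_snoc[of E "z # p''" w y u] by (auto simp: N_edge)
  qed
qed

text \<open>By the girth condition an outside vertex sees at most one deleted vertex, except that it may see
  several deep ones.\<close>

lemma co_legs:
  fixes ls :: "('a \<times> 'a set \<times> 'a set) list"
  assumes z: "z \<in> U" and ls: "\<And>x Q D. (x, Q, D) \<in> set ls \<Longrightarrow> leg z x Q D"
    and N: "N z \<subseteq> fst ` set ls"
    and S: "S = insert z (\<Union>(x, Q, D)\<in>set ls. Q)"
    and D: "(\<Union>(x, Q, D)\<in>set ls. D) \<subseteq> {e, f}"
    and deep: "\<And>u. u \<in> U \<Longrightarrow> e \<noteq> f \<Longrightarrow> two_leg u e \<Longrightarrow> two_leg u f \<Longrightarrow> 4 \<le> d u"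
  shows "co S \<and> S \<subseteq> U"
proof
  show SU: "S \<subseteq> U" using z ls unfolding S leg_def by fastforce
  show "co S"
  proof (rule co_start[OF SU])
    show "S \<noteq> {}" by (simp add: S)
    fix u assume u: "u \<in> U - S"
    \<comment> \<open>A deleted neighbour \<open>s\<close> of \<open>u\<close> yields a walk from
      \<open>z\<close> to \<open>u\<close> with at most four edges, or with five if \<open>s\<close>
      is deep.\<close>
    have walk: "\<exists>p. nbwalk E (z # p @ [u]) \<and> last (z # p) = s \<and> (length p \<le> 3 \<or> length p = 4 \<and> s \<in> {e, f} \<and> two_leg u s)"
      if s: "s \<in> S" "s \<in> N u" for s
    proof (cases "s = z")
      case True
      then show ?thesis using s u N_sym[of u s] by (intro exI[of _ "[]"]) (simp add: N_edge)
    next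
      case False
      then obtain x Q D where xQ: "(x, Q, D) \<in> set ls" "s \<in> Q" using s(1) by (auto simp: S)
      have L: "leg z x Q D" using ls xQ by blast
      have QS: "insert z Q \<subseteq> S" using xQ(1) by (force simp: S)
      obtain p where p: "nbwalk E (z # x # p)" "last (x # p) = s" "set (x # p) \<subseteq> Q"
        "length p \<le> 2 \<or> length p = 3 \<and> s \<in> D" using leg_walk[OF L xQ(2)] .
      have us: "u \<in> N s" using s u N_sym by blast
      have "nbwalk E (z # (x # p) @ [u])"
        using nbwalk_leave[of z "x # p" S u] p us u QS by auto
      moreover have "two_leg u s" if "s \<in> D"
        using L that us u QS unfolding leg_def by blast
      moreover have "s \<in> {e, f}" if "s \<in> D" using D xQ(1) that by fastforce
      ultimately show ?thesis using p(2,4) by (intro exI[of _ "x # p"]) auto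
    qed
    \<comment> \<open>Legs stop only at branch vertices, so an outside vertex of degree two loses
      nothing.\<close>
    have branch: "3 \<le> d u" if s: "s \<in> S" "s \<in> N u" for s
    proof -
      have us: "u \<in> N s" using s u N_sym by blast
      show ?thesis
      proof (cases "s = z")
        case True
        then obtain Q D where "(u, Q, D) \<in> set ls" using us N by force
        moreover from this have "u \<notin> Q" using u by (force simp: S)
        ultimately show ?thesis using ls unfolding leg_def by blast
      next
        case False
        then obtain x Q D where xQ: "(x, Q, D) \<in> set ls" "s \<in> Q" using s(1) by (auto simp: S)
        have "insert z Q \<subseteq> S" using xQ(1) by (force simp: S)
        then show ?thesis using ls[OF xQ(1)] xQ(2) us u unfolding leg_def by blast
      qed
    qed
    \<comment> \<open>Two deleted neighbours give two different walks from \<open>z\<close> to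
      \<open>u\<close>. By girth they have more than nine edges together, so both have five and both
      neighbours are deep.\<close>
    have pair: "s \<in> {e, f} \<and> s' \<in> {e, f} \<and> two_leg u s \<and> two_leg u s'"
      if s: "s \<in> S" "s \<in> N u" "s' \<in> S" "s' \<in> N u" "s \<noteq> s'" for s s'
    proof -
      obtain p where p: "nbwalk E (z # p @ [u])" "last (z # p) = s"
        "length p \<le> 3 \<or> length p = 4 \<and> s \<in> {e, f} \<and> two_leg u s" using walk[OF s(1,2)] by blast
      obtain p' where p': "nbwalk E (z # p' @ [u])" "last (z # p') = s'"
        "length p' \<le> 3 \<or> length p' = 4 \<and> s' \<in> {e, f} \<and> two_leg u s'" using walk[OF s(3,4)] by blast
      have "p \<noteq> p'" using p(2) p'(2) s(5) by auto
      then have "\<not> length (p @ [u]) + length (p' @ [u]) \<le> 9"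
        using walk_unique[OF p(1) p'(1)] by auto
      then show ?thesis using p(3) p'(3) by auto
    qed
    have fin: "finite (N u \<inter> S)" by simp
    \<comment> \<open>Two losses occur only at degree at least four, one loss only at degree at
      least three.\<close>
    have "card (N u \<inter> S) + 2 \<le> d u"
    proof (cases "\<exists>s s'. s \<in> N u \<inter> S \<and> s' \<in> N u \<inter> S \<and> s \<noteq> s'")
      case True
      then obtain s s' where s: "s \<in> N u" "s \<in> S" "s' \<in> N u" "s' \<in> S" "s \<noteq> s'" by blast
      have "N u \<inter> S \<subseteq> {e, f}" using pair s by blast
      then have "card (N u \<inter> S) \<le> 2" using card_le_length[of "N u \<inter> S" "[e, f]"] by simp
      moreover have "e \<noteq> f" "two_leg u e" "two_leg u f" using pair[of s s'] s by auto
      then have "4 \<le> d u" using deep u by blast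
      ultimately show ?thesis by simp
    next
      case False
      then have "card (N u \<inter> S) \<le> 1" using card_le_Suc0_iff_eq[OF fin] by auto
      show ?thesis
      proof (cases "N u \<inter> S = {}")
        case True
        then show ?thesis using d_ge2[of u] u by simp
      next
        case False
        then have "3 \<le> d u" using branch by blast
        then show ?thesis using \<open>card (N u \<inter> S) \<le> 1\<close> by simp
      qed
    qed
    moreover have "card (N u) = card (N u \<inter> S) + card (N u - S)"
      using card_Int_Diff finite_N by blast
    ultimately show "2 \<le> card (N u - S)" by simp
  qed
qed

lemma leg_one:
  assumes "x \<in> U" "one_leg z x"
  shows "leg z x {x} {}"
proof -
  have "{z, x} \<in> E" using assms N_edge[of z x] by (auto simp: one_leg_def insert_commute)
  then have "\<exists>p. nbwalk E (z # x # p) \<and> last (x # p) = x \<and> set (x # p) \<subseteq> {x} \<and> length p \<le> 2"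
    by (intro exI[of _ "[]"]) simp
  then show ?thesis using assms unfolding leg_def one_leg_def by auto
qed

lemma leg_two:
  assumes "N x = {z, x'}" "z \<noteq> x'" "N x' = {x, y}" "x \<noteq> y" "3 \<le> d y" "x \<in> U"
  shows "leg z x {x, x'} {}"
proof -
  have zx: "{z, x} \<in> E" and xx: "{x, x'} \<in> E"
    using N_edge[of z x] N_edge[of x' x] assms by (auto simp: insert_commute)
  have "x' \<in> U" using N_subset[of x] assms by auto
  have "nbwalk E [z, x]" "nbwalk E [z, x, x']" using zx xx assms by auto
  then have "\<exists>p. nbwalk E (z # x # p) \<and> last (x # p) = q \<and> set (x # p) \<subseteq> {x, x'} \<and> length p \<le> 2"
    if "q \<in> {x, x'}" for q
    using that
    by (cases "q = x") (rule exI[of _ "[]"], simp, rule exI[of _ "[x']"], simp)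
  then show ?thesis using assms \<open>x' \<in> U\<close> unfolding leg_def by auto
qed

text \<open>The vertices of \<open>Q\<close> can be coloured while \<open>z\<close> is still uncoloured.\<close>

definition optional :: "'a \<Rightarrow> 'a \<Rightarrow> 'a set \<Rightarrow> bool" where
  "optional z x Q \<longleftrightarrow> leg z x Q {} \<and> (\<forall>L. insert z Q \<subseteq> L \<longrightarrow> L \<subseteq> U \<longrightarrow> co L \<longrightarrow> co (L - Q))"

lemma optional_branch: "3 \<le> d x \<Longrightarrow> optional z x {}"
  by (simp add: optional_def leg_def)

lemma optional_two:
  assumes "x \<in> U" "two_leg z x"
  shows "\<exists>Q. optional z x Q"
proof -
  obtain x' y where x: "N x = {z, x'}" "z \<noteq> x'" "N x' = {x, y}" "x \<noteq> y" "3 \<le> d y"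
    using assms(2) unfolding two_leg_def by blast
  \<comment> \<open>The far vertex \<open>x'\<close> may see the colour of \<open>y\<close>; then
    \<open>x\<close> sees none, because \<open>z\<close> is still uncoloured.\<close>
  have "co (L - {x, x'})" if "insert z {x, x'} \<subseteq> L" "L \<subseteq> U" "co L" for L
    using that x notin_N[of x]
    by (intro co_ext2[OF that(3,2), of x' x y]) auto
  then show ?thesis using leg_two[OF x assms(1)] unfolding optional_def by blast
qed

text \<open>The part of \<open>Q\<close> beyond \<open>x'\<close> can be coloured while \<open>z\<close> is still uncoloured, and afterwards \<open>x'\<close> sees
  at most two colours. Two kinds of legs have this property: those with two vertices of degree two, and
  those where \<open>x'\<close> is poor.\<close>

definition good :: "'a \<Rightarrow> 'a \<Rightarrow> 'a \<Rightarrow> 'a set \<Rightarrow> 'a set \<Rightarrow> bool" where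
  "good z x x' Q D \<longleftrightarrow> leg z x Q D \<and> N x = {z, x'} \<and> x \<noteq> x' \<and> {x, x'} \<subseteq> Q \<and>
    (\<exists>e. D \<subseteq> {e}) \<and> (\<exists>p q. N x' \<subseteq> {x, p, q}) \<and>
    (\<forall>L. insert z Q \<subseteq> L \<longrightarrow> L \<subseteq> U \<longrightarrow> co L \<longrightarrow> co (L - (Q - {x, x'})))"

lemma good_two:
  assumes "x \<in> U" "two_leg z x"
  shows "\<exists>x' Q D. good z x x' Q D"
proof -
  obtain x' y where x: "N x = {z, x'}" "z \<noteq> x'" "N x' = {x, y}" "x \<noteq> y" "3 \<le> d y"
    using assms(2) unfolding two_leg_def by blast
  have "x \<noteq> x'" using x(1) notin_N[of x] by auto
  moreover have "leg z x {x, x'} {}" by (rule leg_two[OF x assms(1)])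
  moreover have "\<exists>p q. N x' \<subseteq> {x, p, q}" using x by auto
  ultimately have "good z x x' {x, x'} {}" using x(1) by (simp add: good_def)
  then show ?thesis by blast
qed

lemma walk_distinct: "nbwalk E p \<Longrightarrow> length p \<le> 10 \<Longrightarrow> distinct p"
  using nbwalk_distinct[of E V p] edge girth by blast

text \<open>Here the deleted set passes through \<open>b\<close> and the poor vertex
  \<open>v\<close> and includes the other two threads at \<open>v\<close>: \<open>a\<close>,
  \<open>a'\<close> and the single vertex \<open>c\<close>. The vertex \<open>a'\<close> is four
  steps from \<open>z\<close> and is the only deep one.\<close>

lemma good_poor:
  assumes "N b = {z, v}" "z \<noteq> v" "3 \<le> d z" "poor v" "b \<in> U"
  shows "\<exists>x' Q D. good z b x' Q D"
proof -
  obtain a b' c where v: "v \<in> U" "N v = {a, b', c}" "distinct [a, b', c]" "two_leg v a"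
    "one_leg v b'" "one_leg v c"
    using assms(4) unfolding poor_def by blast
  obtain a' y where a: "N a = {v, a'}" "v \<noteq> a'" "N a' = {a, y}" "a \<noteq> y" "3 \<le> d y"
    using v(4) unfolding two_leg_def by blast
  have dv: "3 \<le> d v" using v by auto
  \<comment> \<open>The thread from \<open>v\<close> back to \<open>z\<close> has one inner vertex,
    so it is not the long one.\<close>
  have ab: "a \<noteq> b"
  proof
    assume "a = b"
    then have "a' = z" using a(1) assms(1,2) by (auto simp: doubleton_eq_iff)
    then show False using a(3,4) assms(3) by auto
  qed
  have "v \<in> N b" using assms(1) by simp
  then have "b \<in> N v" using N_sym assms(5) by blast
  then have "\<exists>c. N v = {b, a, c} \<and> distinct [a, b, c] \<and> one_leg v c"
    using v ab by (cases "b = b'") (auto simp: insert_commute)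
  then obtain c where c: "N v = {b, a, c}" "distinct [a, b, c]" "one_leg v c" by blast
  obtain w where w: "N c = {v, w}" "v \<noteq> w" "3 \<le> d w" using c(3) unfolding one_leg_def by blast
  have U: "b \<in> U" "v \<in> U" "a \<in> U" "c \<in> U" "a' \<in> U"
    using assms(5) v(1) c(1) a(1) N_subset[of v] N_subset[of a] by auto
  have E: "{z, b} \<in> E" "{b, v} \<in> E" "{v, a} \<in> E" "{v, c} \<in> E" "{a, a'} \<in> E"
    using N_edge[of z b] N_edge[of v b] N_edge[of a v] N_edge[of c v] N_edge[of a' a] assms(1) c(1) a(1)
    by (auto simp: insert_commute)
  have walks: "nbwalk E [z, b, v, a, a']" "nbwalk E [z, b, v, a]" "nbwalk E [z, b, v, c]" "nbwalk E [z, b, v]"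
    "nbwalk E [z, b]" "nbwalk E [c, v, a, a']"
    using E assms(2) c(2) a(2) by (auto simp: insert_commute)
  have dist: "distinct [z, b, v, a, a']" "distinct [z, b, v, c]" "distinct [c, v, a, a']"
    using walk_distinct[OF walks(1)] walk_distinct[OF walks(3)] walk_distinct[OF walks(6)] by simp_all
  define Q where "Q = {b, v, a, a', c}"
  \<comment> \<open>Seen from its far end \<open>y\<close>, the thread \<open>a\<close>,
    \<open>a'\<close> starts with \<open>a'\<close>; this is what \<open>co_legs\<close> needs to
    know about a deep vertex.\<close>
  have two: "two_leg y a'"
    unfolding two_leg_def using a dv by (intro exI[of _ a] exI[of _ v]) (auto simp: insert_commute)
  have path: "\<exists>p. nbwalk E (z # b # p) \<and> last (b # p) = q \<and> set (b # p) \<subseteq> Q \<and>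
      (length p \<le> 2 \<or> length p = 3 \<and> q \<in> {a'})" if q: "q \<in> Q" for q
  proof -
    consider "q = b" | "q = v" | "q = a" | "q = c" | "q = a'" using q by (auto simp: Q_def)
    then show ?thesis
    proof cases
      case 1 then show ?thesis using walks by (intro exI[of _ "[]"]) (simp add: Q_def)
    next
      case 2 then show ?thesis using walks by (intro exI[of _ "[v]"]) (simp add: Q_def)
    next
      case 3 then show ?thesis using walks by (intro exI[of _ "[v, a]"]) (simp add: Q_def)
    next
      case 4 then show ?thesis using walks by (intro exI[of _ "[v, c]"]) (simp add: Q_def)
    next
      case 5 then show ?thesis using walks by (intro exI[of _ "[v, a, a']"]) (simp add: Q_def)
    qed
  qed
  have outs: "u \<in> insert z Q \<or> 3 \<le> d u" if "q \<in> Q" "u \<in> N q" for q u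
    using that assms(1) c(1) a w unfolding Q_def by auto
  have deep: "u \<in> insert z Q \<or> two_leg u q" if "q \<in> {a'}" "u \<in> N q" for q u
    using that a(3) two unfolding Q_def by auto
  have "leg z b Q {a'}"
    unfolding leg_def using path outs deep U by (auto simp: Q_def)
  \<comment> \<open>While \<open>v\<close> is uncoloured, \<open>c\<close> sees at most
    \<open>w\<close>, then \<open>a'\<close> at most \<open>y\<close>, and \<open>a\<close> nothing.
    Afterwards \<open>v\<close> has at most the two coloured neighbours \<open>a\<close> and
    \<open>c\<close>.\<close>
  moreover have "co (L - (Q - {b, v}))" if L: "insert z Q \<subseteq> L" "L \<subseteq> U" "co L" for L
  proof (rule co_ext3[OF L(3,2), of c a' a w w y])
    show "{c, a', a} \<subseteq> L" using L by (auto simp: Q_def)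
    show "distinct [c, a', a]" using dist by auto
    show "L - (Q - {b, v}) = L - {c, a', a}" using dist by (auto simp: Q_def)
    show "N c - L \<subseteq> {w, w}" "N a' - L \<subseteq> {y}" "N a \<subseteq> L"
      using w a L(1) by (auto simp: Q_def)
  qed
  ultimately have "good z b v Q {a'}"
    unfolding good_def using assms(1) dist c(1) by (auto simp: Q_def)
  then show ?thesis by blast
qed

lemma goodE:
  assumes "good z x x' Q D"
  obtains e p q where "leg z x Q D" "N x = {z, x'}" "x \<noteq> x'" "{x, x'} \<subseteq> Q" "D \<subseteq> {e}"
    "N x' \<subseteq> {x, p, q}"
proof -
  have "\<exists>e. D \<subseteq> {e}" "\<exists>p q. N x' \<subseteq> {x, p, q}" using assms by (simp_all add: good_def)
  then obtain e p q where "D \<subseteq> {e}" "N x' \<subseteq> {x, p, q}" by blast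
  moreover have "leg z x Q D" "N x = {z, x'}" "x \<noteq> x'" "{x, x'} \<subseteq> Q"
    using assms by (simp_all add: good_def)
  ultimately show ?thesis using that by blast
qed

section \<open>Reducible configurations\<close>

lemma optional_co: "co L \<Longrightarrow> optional z x Q \<Longrightarrow> insert z Q \<subseteq> L \<Longrightarrow> L \<subseteq> U \<Longrightarrow> co (L - Q)"
  by (simp add: optional_def)

lemma good_co:
  "co L \<Longrightarrow> good z x x' Q D \<Longrightarrow> insert z Q \<subseteq> L \<Longrightarrow> L \<subseteq> U \<Longrightarrow> co (L - (Q - {x, x'}))"
  by (simp add: good_def)

text \<open>Colour the optional legs first. In the final group \<open>z\<close>, \<open>x'\<close>,
  \<open>x\<close> the numbers of coloured neighbours are at most 2, 1, 0.\<close>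

lemma config_two_opt_opt:
  assumes z: "z \<in> U" "N z = {x, y, t}" "distinct [x, y, t]"
    and x: "two_leg z x" and y: "optional z y Y" and t: "optional z t T"
  shows False
proof -
  obtain x' w where x: "N x = {z, x'}" "z \<noteq> x'" "N x' = {x, w}" "x \<noteq> w" "3 \<le> d w"
    using x unfolding two_leg_def by blast
  have xU: "x \<in> U" using N_subset[of z] z by auto
  note X = leg_two[OF x xU]
  have Y: "leg z y Y {}" and T: "leg z t T {}" using y t by (auto simp: optional_def)
  have xx: "x \<noteq> x'" using x(1) notin_N[of x] by auto
  have dj: "{x, x'} \<inter> Y = {}" "{x, x'} \<inter> T = {}" "Y \<inter> T = {}" "z \<notin> {x, x'}" "z \<notin> Y" "z \<notin> T"
    using leg_disjoint[OF X Y] leg_disjoint[OF X T] leg_disjoint[OF Y T] z(3)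
      leg_root[OF X] leg_root[OF Y] leg_root[OF T] by auto
  define S where "S = insert z ({x, x'} \<union> Y \<union> T)"
  have "co S \<and> S \<subseteq> U"
    by (rule co_legs[of z "[(x, {x, x'}, {}), (y, Y, {}), (t, T, {})]" S z z]) (use X Y T z in \<open>auto simp: S_def\<close>)
  then have S: "co S" "S \<subseteq> U" by auto
  have "co (S - Y)" by (rule optional_co[OF S(1) y _ S(2)]) (auto simp: S_def)
  then have "co (S - Y - T)" by (rule optional_co[OF _ t]) (use S dj in \<open>auto simp: S_def\<close>)
  moreover have "S - Y - T = {z, x', x}" using dj by (auto simp: S_def)
  ultimately have "co {z, x', x}" by simp
  then have "co {}"
    by (rule co_ext3[of "{z, x', x}" z x' x y t w]) (use z x xU dj xx N_subset[of x] in auto)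
  then show False using not_co_empty by simp
qed

text \<open>After the optional leg and the remote part of the good leg, the group \<open>z\<close>,
  \<open>x'\<close>, \<open>y\<close>, \<open>x\<close> remains, with at most 1, 2, 1, 0 coloured
  neighbours.\<close>

lemma config_good_one_opt:
  assumes z: "z \<in> U" "N z = {x, y, t}" "distinct [x, y, t]"
    and x: "good z x x' Q D" and y: "one_leg z y" and t: "optional z t T"
  shows False
proof -
  obtain w where w: "N y = {z, w}" "z \<noteq> w" "3 \<le> d w" using y unfolding one_leg_def by blast
  obtain e p q where x': "leg z x Q D" "N x = {z, x'}" "x \<noteq> x'" "{x, x'} \<subseteq> Q" "D \<subseteq> {e}"
    "N x' \<subseteq> {x, p, q}" using goodE[OF x] .
  have yU: "y \<in> U" using N_subset[of z] z by auto
  note Y = leg_one[OF yU y]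
  have T: "leg z t T {}" using t by (auto simp: optional_def)
  have dj: "Q \<inter> {y} = {}" "Q \<inter> T = {}" "{y} \<inter> T = {}" "z \<notin> Q" "z \<notin> {y}" "z \<notin> T"
    using leg_disjoint[OF x'(1) Y] leg_disjoint[OF x'(1) T] leg_disjoint[OF Y T] z(3)
      leg_root[OF x'(1)] leg_root[OF Y] leg_root[OF T] by auto
  define S where "S = insert z (Q \<union> {y} \<union> T)"
  have "co S \<and> S \<subseteq> U"
    by (rule co_legs[of z "[(x, Q, D), (y, {y}, {}), (t, T, {})]" S e e]) (use x' Y T z in \<open>auto simp: S_def\<close>)
  then have S: "co S" "S \<subseteq> U" by auto
  have "co (S - T)" by (rule optional_co[OF S(1) t _ S(2)]) (auto simp: S_def)
  then have "co (S - T - (Q - {x, x'}))"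
    by (rule good_co[OF _ x]) (use S dj in \<open>auto simp: S_def\<close>)
  moreover have "S - T - (Q - {x, x'}) = {z, x', y, x}" using dj x'(4) by (auto simp: S_def)
  moreover have "Q \<subseteq> U" using x'(1) by (simp add: leg_def)
  ultimately have "co {z, x', y, x}" "{z, x', y, x} \<subseteq> U" using z x' yU by auto
  then have "co {}"
    by (rule co_ext4[of "{z, x', y, x}" z x' y x t t t p q w]) (use z x' yU dj w in auto)
  then show False using not_co_empty by simp
qed

text \<open>One group suffices: each of \<open>x\<close>, \<open>y\<close>, \<open>t\<close> sees
  only the far end of its thread, and \<open>z\<close>, placed last, sees no colour.\<close>

lemma config_one_one_one:
  assumes z: "z \<in> U" "N z = {x, y, t}" "distinct [x, y, t]"
    and "one_leg z x" "one_leg z y" "one_leg z t"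
  shows False
proof -
  obtain w where x: "N x = {z, w}" using assms(4) unfolding one_leg_def by blast
  obtain w' where y: "N y = {z, w'}" using assms(5) unfolding one_leg_def by blast
  obtain w'' where t: "N t = {z, w''}" using assms(6) unfolding one_leg_def by blast
  have U: "x \<in> U" "y \<in> U" "t \<in> U" using N_subset[of z] z by auto
  note L = leg_one[OF U(1) assms(4)] leg_one[OF U(2) assms(5)] leg_one[OF U(3) assms(6)]
  define S where "S = {z, x, y, t}"
  have "co S \<and> S \<subseteq> U"
    by (rule co_legs[of z "[(x, {x}, {}), (y, {y}, {}), (t, {t}, {})]" S z z]) (use L z in \<open>auto simp: S_def\<close>)
  then have "co S" "S \<subseteq> U" by auto
  then have "co {}"
    by (rule co_ext4[of S x y t z w w w w' w' w'']) (use z x y t notin_N[of z] in \<open>auto simp: S_def\<close>)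
  then show False using not_co_empty by simp
qed

text \<open>After the optional legs five vertices remain, one more than a group can hold. So
  \<open>x\<close> is coloured alone while both its neighbours are uncoloured; then
  \<open>z\<close>, \<open>x'\<close>, \<open>y'\<close>, \<open>y\<close> see at most 3, 2, 1, 0
  colours.\<close>

lemma config_two_two_opt_opt:
  assumes z: "z \<in> U" "N z = {x, y, s, t}" "distinct [x, y, s, t]"
    and "two_leg z x" "two_leg z y" and s: "optional z s R" and t: "optional z t T"
  shows False
proof -
  obtain x' w where x: "N x = {z, x'}" "z \<noteq> x'" "N x' = {x, w}" "x \<noteq> w" "3 \<le> d w"
    using assms(4) unfolding two_leg_def by blast
  obtain y' w' where y: "N y = {z, y'}" "z \<noteq> y'" "N y' = {y, w'}" "y \<noteq> w'" "3 \<le> d w'"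
    using assms(5) unfolding two_leg_def by blast
  have U: "x \<in> U" "y \<in> U" using N_subset[of z] z by auto
  note X = leg_two[OF x U(1)] and Y = leg_two[OF y U(2)]
  have R: "leg z s R {}" and T: "leg z t T {}" using s t by (auto simp: optional_def)
  have xx: "x \<noteq> x'" "y \<noteq> y'" using x(1) y(1) notin_N[of x] notin_N[of y] by auto
  have dj: "{x, x'} \<inter> {y, y'} = {}" "{x, x'} \<inter> R = {}" "{x, x'} \<inter> T = {}" "{y, y'} \<inter> R = {}"
    "{y, y'} \<inter> T = {}" "R \<inter> T = {}" "z \<notin> {x, x'}" "z \<notin> {y, y'}" "z \<notin> R" "z \<notin> T"
    using leg_disjoint[OF X Y] leg_disjoint[OF X R] leg_disjoint[OF X T] leg_disjoint[OF Y R]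
      leg_disjoint[OF Y T] leg_disjoint[OF R T] z(3)
      leg_root[OF X] leg_root[OF Y] leg_root[OF R] leg_root[OF T] by auto
  define S where "S = insert z ({x, x'} \<union> {y, y'} \<union> R \<union> T)"
  have "co S \<and> S \<subseteq> U"
    by (rule co_legs[of z "[(x, {x, x'}, {}), (y, {y, y'}, {}), (s, R, {}), (t, T, {})]" S z z]) (use X Y R T z in \<open>auto simp: S_def\<close>)
  then have S: "co S" "S \<subseteq> U" by auto
  have "co (S - R)" by (rule optional_co[OF S(1) s _ S(2)]) (auto simp: S_def)
  then have "co (S - R - T)" by (rule optional_co[OF _ t]) (use S dj in \<open>auto simp: S_def\<close>)
  moreover have "S - R - T = {z, x', x, y, y'}" using dj by (auto simp: S_def)
  ultimately have "co {z, x', x, y, y'}" by simp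
  then have "co {z, x', y', y}"
    by (rule co_ext1[of "{z, x', x, y, y'}" x]) (use S x dj xx z(3) in \<open>auto simp: S_def\<close>)
  then have "co {}"
    by (rule co_ext4[of "{z, x', y', y}" z x' y' y s t x w x w']) (use z x y S dj xx in \<open>auto simp: S_def\<close>)
  then show False using not_co_empty by simp
qed

text \<open>As in degree three, with one more coloured neighbour at \<open>z\<close>: the bounds for
  \<open>z\<close>, \<open>x'\<close>, \<open>y\<close>, \<open>x\<close> are 2, 2, 1, 0.\<close>

lemma config_good_one_opt_opt:
  assumes z: "z \<in> U" "N z = {x, y, s, t}" "distinct [x, y, s, t]"
    and x: "good z x x' Q D" and y: "one_leg z y" and s: "optional z s R" and t: "optional z t T"
  shows False
proof -
  obtain w where w: "N y = {z, w}" "z \<noteq> w" "3 \<le> d w" using y unfolding one_leg_def by blast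
  obtain e p q where x': "leg z x Q D" "N x = {z, x'}" "x \<noteq> x'" "{x, x'} \<subseteq> Q" "D \<subseteq> {e}"
    "N x' \<subseteq> {x, p, q}" using goodE[OF x] .
  have yU: "y \<in> U" using N_subset[of z] z by auto
  note Y = leg_one[OF yU y]
  have R: "leg z s R {}" and T: "leg z t T {}" using s t by (auto simp: optional_def)
  have dj: "Q \<inter> {y} = {}" "Q \<inter> T = {}" "{y} \<inter> T = {}" "Q \<inter> R = {}" "{y} \<inter> R = {}" "R \<inter> T = {}"
      "z \<notin> Q" "z \<notin> {y}" "z \<notin> R" "z \<notin> T"
    using leg_disjoint[OF x'(1) Y] leg_disjoint[OF x'(1) T] leg_disjoint[OF Y T]
      leg_disjoint[OF x'(1) R] leg_disjoint[OF Y R] leg_disjoint[OF R T] z(3)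
      leg_root[OF x'(1)] leg_root[OF Y] leg_root[OF T] leg_root[OF R] by auto
  define S where "S = insert z (Q \<union> {y} \<union> R \<union> T)"
  have "co S \<and> S \<subseteq> U"
    by (rule co_legs[of z "[(x, Q, D), (y, {y}, {}), (s, R, {}), (t, T, {})]" S e e]) (use x' Y R T z in \<open>auto simp: S_def\<close>)
  then have S: "co S" "S \<subseteq> U" by auto
  have "co (S - R)" by (rule optional_co[OF S(1) s _ S(2)]) (auto simp: S_def)
  then have "co (S - R - T)" by (rule optional_co[OF _ t]) (use S dj in \<open>auto simp: S_def\<close>)
  then have "co (S - R - T - (Q - {x, x'}))"
    by (rule good_co[OF _ x]) (use S dj in \<open>auto simp: S_def\<close>)
  moreover have "S - R - T - (Q - {x, x'}) = {z, x', y, x}" using dj x'(4) by (auto simp: S_def)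
  moreover have "Q \<subseteq> U" using x'(1) by (simp add: leg_def)
  ultimately have "co {z, x', y, x}" "{z, x', y, x} \<subseteq> U" using z x' yU by auto
  then have "co {}"
    by (rule co_ext4[of "{z, x', y, x}" z x' y x s t t p q w]) (use z x' yU dj w in auto)
  then show False using not_co_empty by simp
qed

text \<open>Two deep vertices may occur here, which is why \<open>two\<close> is assumed. Of the
  seven vertices left, \<open>y'\<close>, \<open>t\<close>, \<open>y\<close> are coloured first (at
  most 2, 1, 0 coloured neighbours), then \<open>z\<close>, \<open>x'\<close>, \<open>s\<close>,
  \<open>x\<close> (at most 2, 2, 1, 0).\<close>

lemma config_good_good_one_one:
  assumes z: "z \<in> U" "N z = {x, y, s, t}" "distinct [x, y, s, t]"
    and x: "good z x x' Q D" and y: "good z y y' P F" and s: "one_leg z s" and t: "one_leg z t"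
    and two: "\<And>u e f. u \<in> U \<Longrightarrow> two_leg u e \<Longrightarrow> two_leg u f \<Longrightarrow> e \<noteq> f \<Longrightarrow> 4 \<le> d u"
  shows False
proof -
  obtain w where w: "N s = {z, w}" "z \<noteq> w" "3 \<le> d w" using s unfolding one_leg_def by blast
  obtain v where v: "N t = {z, v}" "z \<noteq> v" "3 \<le> d v" using t unfolding one_leg_def by blast
  obtain e p q where x': "leg z x Q D" "N x = {z, x'}" "x \<noteq> x'" "{x, x'} \<subseteq> Q" "D \<subseteq> {e}"
    "N x' \<subseteq> {x, p, q}" using goodE[OF x] .
  obtain f p' q' where y': "leg z y P F" "N y = {z, y'}" "y \<noteq> y'" "{y, y'} \<subseteq> P" "F \<subseteq> {f}"
    "N y' \<subseteq> {y, p', q'}" using goodE[OF y] .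
  have U: "s \<in> U" "t \<in> U" using N_subset[of z] z by auto
  note R = leg_one[OF U(1) s] and T = leg_one[OF U(2) t]
  have dj: "Q \<inter> P = {}" "Q \<inter> {s} = {}" "Q \<inter> {t} = {}" "P \<inter> {s} = {}" "P \<inter> {t} = {}"
      "z \<notin> Q" "z \<notin> P" "z \<notin> {s}" "z \<notin> {t}"
    using leg_disjoint[OF x'(1) y'(1)] leg_disjoint[OF x'(1) R] leg_disjoint[OF x'(1) T]
      leg_disjoint[OF y'(1) R] leg_disjoint[OF y'(1) T] z(3)
      leg_root[OF x'(1)] leg_root[OF y'(1)] leg_root[OF T] leg_root[OF R] by auto
  define S where "S = insert z (Q \<union> P \<union> {s} \<union> {t})"
  have "co S \<and> S \<subseteq> U"
    by (rule co_legs[of z "[(x, Q, D), (y, P, F), (s, {s}, {}), (t, {t}, {})]" S e f]) (use x' y' R T z two in \<open>auto simp: S_def\<close>)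
  then have S: "co S" "S \<subseteq> U" by auto
  have "co (S - (Q - {x, x'}))"
    by (rule good_co[OF S(1) x _ S(2)]) (auto simp: S_def)
  then have "co (S - (Q - {x, x'}) - (P - {y, y'}))"
    by (rule good_co[OF _ y]) (use S dj in \<open>auto simp: S_def\<close>)
  moreover have "S - (Q - {x, x'}) - (P - {y, y'}) = {z, x, x', y, y', s, t}"
    using dj x'(4) y'(4) by (auto simp: S_def)
  ultimately have L: "co {z, x, x', y, y', s, t}" by simp
  have LU: "{z, x, x', y, y', s, t} \<subseteq> U" using S x'(4) y'(4) by (auto simp: S_def)
  have ne: "distinct [z, x, x', y, y', s, t]" using dj x'(3,4) y'(3,4) z(3) by auto
  have "co {z, x', s, x}"
    by (rule co_ext3[OF L LU, of y' t y p' q' v]) (use x' y' z ne v in auto)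
  then have "co {}"
    by (rule co_ext4[of "{z, x', s, x}" z x' s x y t t p q w]) (use z x' LU ne w in auto)
  then show False using not_co_empty by simp
qed


section \<open>Discharging\<close>

text \<open>By \<open>no_long_thread\<close> a thread leaving a branch vertex has at most two inner
  vertices.\<close>

lemma leg_cases:
  assumes "z \<in> U" "3 \<le> d z" "x \<in> N z"
  shows "3 \<le> d x \<or> d x = 2 \<and> one_leg z x \<or> d x = 2 \<and> two_leg z x"
proof (cases "3 \<le> d x")
  case False
  have xU: "x \<in> U" using assms N_subset by blast
  then have dx: "d x = 2" using False d_ge2[of x] by simp
  have "z \<in> N x" using assms N_sym by blast
  then have "card (N x - {z}) = 1" using dx by simp
  then obtain x' where x': "N x - {z} = {x'}" using card_1_singletonE by blast
  then have Nx: "N x = {z, x'}" "z \<noteq> x'" using \<open>z \<in> N x\<close> by auto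
  have "x' \<in> U" using Nx N_subset[of x] by auto
  have "x \<in> N x'" using Nx(1) N_sym[OF xU, of x'] by simp
  show ?thesis
  proof (cases "3 \<le> d x'")
    case True
    then show ?thesis using Nx dx unfolding one_leg_def by blast
  next
    case False
    then have dx': "d x' = 2" using d_ge2[OF \<open>x' \<in> U\<close>] by simp
    then have "card (N x' - {x}) = 1" using \<open>x \<in> N x'\<close> by simp
    then obtain y where y: "N x' - {x} = {y}" using card_1_singletonE by blast
    then have Ny: "N x' = {x, y}" "x \<noteq> y" using \<open>x \<in> N x'\<close> by auto
    have "y \<in> U" using Ny N_subset[of x'] by auto
    moreover have "d y \<noteq> 2" using no_long_thread[of x x' y] Ny dx dx' \<open>x' \<in> U\<close> by auto
    ultimately have "3 \<le> d y" using d_ge2[of y] by simp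
    then show ?thesis using Nx Ny dx unfolding two_leg_def by blast
  qed
qed simp

lemma leg_exclusive: "two_leg z x \<Longrightarrow> \<not> one_leg z x"
  by (auto simp: one_leg_def two_leg_def doubleton_eq_iff card_insert_if)

lemma two_leg_nbr:
  assumes "two_leg z x"
  shows "x \<in> U" "z \<in> N x" "d x = 2"
proof -
  obtain x' y where x: "N x = {z, x'}" "z \<noteq> x'" "N x' = {x, y}"
    using assms unfolding two_leg_def by blast
  show "x \<in> U" using x(3) N_subset[of x'] by auto
  show "z \<in> N x" "d x = 2" using x by auto
qed

text \<open>At degree two the long thread would continue through \<open>u\<close>. At degree three
  each type of the third leg completes a reducible configuration, the second long leg serving as an
  optional one.\<close>

lemma two_two_legs:
  assumes u: "u \<in> U" and e: "two_leg u e" and f: "two_leg u f" and ef: "e \<noteq> f"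
  shows "4 \<le> d u"
proof (rule ccontr)
  assume "\<not> ?thesis"
  obtain e' y where e': "N e = {u, e'}" "u \<noteq> e'" "N e' = {e, y}" "e \<noteq> y"
    using e unfolding two_leg_def by blast
  have "d u \<noteq> 2" using no_long_thread[of u e e'] e' two_leg_nbr[OF e] by auto
  then have du: "d u = 3" using d_ge2[OF u] \<open>\<not> 4 \<le> d u\<close> by simp
  have mem: "e \<in> N u" "f \<in> N u" using N_sym two_leg_nbr[OF e] two_leg_nbr[OF f] by blast+
  then have "card (N u - {e, f}) = 1" using du ef by simp
  then obtain t where t: "N u - {e, f} = {t}" using card_1_singletonE by blast
  then have Nu: "N u = {e, f, t}" "distinct [e, f, t]" using mem ef by auto
  have tU: "t \<in> U" using Nu N_subset[of u] by auto
  obtain F where F: "optional u f F" using optional_two two_leg_nbr[OF f] f by blast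
  have "t \<in> N u" "3 \<le> d u" using Nu(1) du by auto
  then consider "3 \<le> d t" | "one_leg u t" | "two_leg u t" using leg_cases[OF u, of t] by blast
  then show False
  proof cases
    case 1
    then show ?thesis using config_two_opt_opt[OF u Nu e F optional_branch] by blast
  next
    case 2
    obtain e'' Q D where "good u e e'' Q D" using good_two two_leg_nbr[OF e] e by blast
    moreover have "N u = {e, t, f}" "distinct [e, t, f]" using Nu by auto
    ultimately show ?thesis using config_good_one_opt[OF u] 2 F by blast
  next
    case 3
    obtain T where "optional u t T" using optional_two tU 3 by blast
    then show ?thesis using config_two_opt_opt[OF u Nu e F] by blast
  qed
qed

lemma poor_degree: "poor v \<Longrightarrow> d v = 3"
  by (auto simp: poor_def)

text \<open>A vertex between two poor vertices would receive no charge. But seen from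
  \<open>p\<close>, the leg through \<open>x\<close> is good because \<open>q\<close> is poor, and
  together with the other two legs of \<open>p\<close> this is
  \<open>config_good_one_opt\<close>.\<close>

lemma poor_not_linked:
  assumes "poor p" "poor q" "N x = {p, q}" "p \<noteq> q" "x \<in> U"
  shows False
proof -
  obtain a b c where p: "p \<in> U" "N p = {a, b, c}" "distinct [a, b, c]" "two_leg p a" "one_leg p b" "one_leg p c"
    using assms(1) unfolding poor_def by blast
  have "one_leg p x" using assms poor_degree[of q] unfolding one_leg_def by auto
  then have "x \<noteq> a" using p(4) leg_exclusive by blast
  moreover have "x \<in> N p" using N_sym[of x p] assms by auto
  ultimately have "\<exists>y. N p = {x, y, a} \<and> distinct [x, y, a] \<and> one_leg p y"
    using p by (cases "x = b") (auto simp: insert_commute)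
  then obtain y where y: "N p = {x, y, a}" "distinct [x, y, a]" "one_leg p y" by blast
  obtain x' Q D where "good p x x' Q D"
    using good_poor[of x p q] assms poor_degree[OF assms(1)] by auto
  moreover obtain A where "optional p a A" using optional_two two_leg_nbr p(4) by blast
  ultimately show False using config_good_one_opt[OF p(1) y(1,2)] y(3) by blast
qed

text \<open>Every vertex \<open>x\<close> of degree two is to receive two units. If it has two branch neighbours and one of
  them is poor, then it takes everything from the other one.\<close>

definition wt :: "'a \<Rightarrow> 'a \<Rightarrow> nat" where
  "wt v x = (if 3 \<le> d x then 0 else if two_leg v x then 2 else if poor v then 0
    else if \<exists>u. N x = {v, u} \<and> v \<noteq> u \<and> poor u then 2 else 1)"

lemma wt_received:
  assumes x: "x \<in> U" "d x = 2"
  shows "2 \<le> (\<Sum>v \<in> {v \<in> N x. 3 \<le> d v}. wt v x)"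
proof -
  obtain p q where pq: "N x = {p, q}" "p \<noteq> q" using x(2) by (meson card_2_iff)
  have U: "p \<in> U" "q \<in> U" using pq N_subset[of x] by auto
  have mem: "x \<in> N p" "x \<in> N q" using N_sym[OF x(1)] pq by auto
  \<comment> \<open>If the other neighbour has degree two, then \<open>x\<close> lies on a thread
    with two inner vertices and takes both units from its own end.\<close>
  have lonely: "wt v x = 2"
    if "N x = {v, u}" "v \<noteq> u" "d u = 2" "v \<in> U" "3 \<le> d v" "x \<in> N v" for u v
  proof -
    have "\<not> one_leg v x" using that(1-3) by (auto simp: one_leg_def doubleton_eq_iff)
    then have "two_leg v x" using leg_cases[OF that(4-6)] x(2) by auto
    then show ?thesis using x(2) by (simp add: wt_def)
  qed
  have not2: "\<not> (d p = 2 \<and> d q = 2)" using no_long_thread[of p x q] pq x by auto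
  then consider "d p = 2" "3 \<le> d q" | "d q = 2" "3 \<le> d p" | "3 \<le> d p" "3 \<le> d q"
    using d_ge2[OF U(1)] d_ge2[OF U(2)] by linarith
  then show ?thesis
  proof cases
    case 1
    then have "{v \<in> N x. 3 \<le> d v} = {q}" using pq by auto
    then show ?thesis using lonely[of q p] pq U mem 1 by (simp add: insert_commute)
  next
    case 2
    then have "{v \<in> N x. 3 \<le> d v} = {p}" using pq by auto
    then show ?thesis using lonely[of p q] pq U mem 2 by simp
  next
    case 3
    then have "{v \<in> N x. 3 \<le> d v} = {p, q}" using pq by auto
    then have "(\<Sum>v \<in> {v \<in> N x. 3 \<le> d v}. wt v x) = wt p x + wt q x" using pq(2) by simp
    moreover have one: "one_leg p x" "one_leg q x"
      using pq 3 unfolding one_leg_def by (auto simp: insert_commute)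
    then have "\<not> two_leg p x" "\<not> two_leg q x" using leg_exclusive by blast+
    moreover have "\<not> (poor p \<and> poor q)" using poor_not_linked pq x(1) by blast
    moreover have "(\<exists>u. N x = {p, u} \<and> p \<noteq> u \<and> poor u) = poor q"
      "(\<exists>u. N x = {q, u} \<and> q \<noteq> u \<and> poor u) = poor p"
      using pq by (auto simp: doubleton_eq_iff)
    ultimately show ?thesis using x(2) by (simp add: wt_def)
  qed
qed

lemma wt_le: "wt v x \<le> 2"
  by (simp add: wt_def)

text \<open>The types of legs, each with its cost and with the roles it can play in reducible
  configurations. A one-leg costs 2 exactly when its far end is poor, and then it is good.\<close>

lemma wt_cases:
  assumes "z \<in> U" "3 \<le> d z" "\<not> poor z" "x \<in> N z"
  shows "(\<exists>Q. optional z x Q) \<and> 3 \<le> d x \<and> wt z x = 0 \<or>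
    (\<exists>Q. optional z x Q) \<and> (\<exists>x' Q D. good z x x' Q D) \<and> two_leg z x \<and> wt z x = 2 \<or>
    one_leg z x \<and> wt z x = 1 \<or>
    (\<exists>x' Q D. good z x x' Q D) \<and> one_leg z x \<and> wt z x = 2"
proof -
  have xU: "x \<in> U" using N_subset assms by blast
  consider "3 \<le> d x" | "d x = 2" "one_leg z x" | "d x = 2" "two_leg z x"
    using leg_cases[OF assms(1,2,4)] by blast
  then show ?thesis
  proof cases
    case 1
    then have "wt z x = 0" by (simp add: wt_def)
    then show ?thesis using optional_branch 1 by blast
  next
    case 2
    then have "\<not> two_leg z x" using leg_exclusive by blast
    show ?thesis
    proof (cases "\<exists>u. N x = {z, u} \<and> z \<noteq> u \<and> poor u")
      case True
      then have "wt z x = 2" using 2 \<open>\<not> two_leg z x\<close> assms(3) by (simp add: wt_def)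
      moreover have "\<exists>x' Q D. good z x x' Q D" using True good_poor assms(2) xU by blast
      ultimately show ?thesis using 2 by blast
    next
      case False
      then have "wt z x = 1" using 2 \<open>\<not> two_leg z x\<close> assms(3) unfolding wt_def by simp
      then show ?thesis using 2 by blast
    qed
  next
    case 3
    then have "wt z x = 2" by (simp add: wt_def)
    then show ?thesis using optional_two[OF xU] good_two[OF xU] 3 by blast
  qed
qed

text \<open>The charge 4 * 3 - 10 = 2 is used up by the long thread, so a poor vertex has nothing
  for its one-legs; this is what the exception in \<open>wt\<close> provides for.\<close>

lemma wt_sent_poor:
  assumes "poor z"
  shows "(\<Sum>x\<in>N z. wt z x) = 2"
proof -
  obtain a b c where z: "N z = {a, b, c}" "distinct [a, b, c]" "two_leg z a" "one_leg z b" "one_leg z c"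
    using assms unfolding poor_def by blast
  have "\<not> two_leg z b" "\<not> two_leg z c" using z leg_exclusive by blast+
  moreover have "d a = 2" "d b = 2" "d c = 2" using z(3-5) two_leg_nbr by (auto simp: one_leg_def)
  ultimately show ?thesis using z assms by (simp add: wt_def)
qed

text \<open>Whenever the total is three or more, the legs form a reducible triple or consist of a
  two-leg and two one-legs, which would make \<open>z\<close> poor.\<close>

lemma wt_sent_3:
  assumes z: "z \<in> U" "d z = 3" "\<not> poor z"
  shows "(\<Sum>x\<in>N z. wt z x) \<le> 2"
proof -
  obtain x y t where N: "N z = {x, y, t}" "x \<noteq> y" "x \<noteq> t" "y \<noteq> t"
    using z(2) by (auto simp: card_3_iff)
  define Op where "Op = (\<lambda>x. \<exists>Q. optional z x Q)"
  define G where "G = (\<lambda>x. \<exists>x' Q D. good z x x' Q D)"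
  have cs: "Op u \<and> wt z u = 0 \<or> Op u \<and> G u \<and> two_leg z u \<and> wt z u = 2 \<or>
     one_leg z u \<and> wt z u = 1 \<or> G u \<and> one_leg z u \<and> wt z u = 2" if "u \<in> N z" for u
    using wt_cases[OF z(1) _ z(3) that] z(2) unfolding Op_def G_def by force
  have A: "\<not> (G a \<and> one_leg z b \<and> Op c)" and B: "\<not> (two_leg z a \<and> Op b \<and> Op c)"
    and C: "\<not> (one_leg z a \<and> one_leg z b \<and> one_leg z c)"
    and P: "\<not> (two_leg z a \<and> one_leg z b \<and> one_leg z c)"
    if perm: "{x, y, t} = {a, b, c}" for a b c
  proof -
    have Nz: "N z = {a, b, c}" using perm N by simp
    have dist: "distinct [a, b, c]"
      by (rule card_distinct) (use Nz z(2) in simp)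
    show "\<not> (G a \<and> one_leg z b \<and> Op c)"
      using config_good_one_opt[OF z(1) Nz dist] unfolding Op_def G_def by blast
    show "\<not> (two_leg z a \<and> Op b \<and> Op c)"
      using config_two_opt_opt[OF z(1) Nz dist] unfolding Op_def by blast
    show "\<not> (one_leg z a \<and> one_leg z b \<and> one_leg z c)"
      using config_one_one_one[OF z(1) Nz dist] by blast
    show "\<not> (two_leg z a \<and> one_leg z b \<and> one_leg z c)"
      using z Nz dist unfolding poor_def by blast
  qed
  have "{x, y, t} = {x, t, y}" "{x, y, t} = {y, x, t}" "{x, y, t} = {y, t, x}"
    "{x, y, t} = {t, x, y}" "{x, y, t} = {t, y, x}" by auto
  note perm = refl[of "{x, y, t}"] this
  have "x \<in> N z" "y \<in> N z" "t \<in> N z" using N by simp_all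
  note cs = cs[OF this(1)] cs[OF this(2)] cs[OF this(3)]
  \<comment> \<open>Purely propositional: the four types for each leg against the excluded triples
    in all orders. \<open>B\<close> and \<open>P\<close> are symmetric in their last two places,
    \<open>C\<close> in all three, hence fewer instances.\<close>
  have "wt z x + wt z y + wt z t \<le> 2"
    using cs
      A[OF perm(1)] A[OF perm(2)] A[OF perm(3)] A[OF perm(4)] A[OF perm(5)] A[OF perm(6)]
      B[OF perm(1)] B[OF perm(3)] B[OF perm(5)] C[OF perm(1)]
      P[OF perm(1)] P[OF perm(3)] P[OF perm(5)]
    by (elim disjE conjE) simp_all
  then show ?thesis using N by simp
qed

lemma wt_sent_4:
  assumes z: "z \<in> U" "d z = 4"
  shows "(\<Sum>x\<in>N z. wt z x) \<le> 6"
proof -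
  have np: "\<not> poor z" using poor_degree z by fastforce
  obtain x y s t where N: "N z = {x, y, s, t}" "distinct [x, y, s, t]"
  proof -
    obtain x where "x \<in> N z" using z(2) by (metis card.empty ex_in_conv zero_neq_numeral)
    moreover from this have "card (N z - {x}) = 3" using z(2) by simp
    ultimately show ?thesis using that unfolding card_3_iff by (metis insert_Diff Diff_iff distinct_length_2_or_more distinct_singleton insertI1 insert_commute)
  qed
  define T where "T = (\<lambda>x. two_leg z x)"
  define G where "G = (\<lambda>x. \<exists>x' Q D. good z x x' Q D)"
  have cs: "wt z u = 0 \<or> G u \<and> T u \<and> wt z u = 2 \<or>
     one_leg z u \<and> wt z u = 1 \<or> G u \<and> one_leg z u \<and> wt z u = 2" if "u \<in> N z" for u
    using wt_cases[OF z(1) _ np that] z(2) unfolding T_def G_def by force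
  \<comment> \<open>Legs of weight 2 are good, so the number of two-legs decides: four give
    \<open>D\<close>, three give \<open>E\<close>, and at most two leave two one-legs beside two
    good legs, which is \<open>F\<close>.\<close>
  have bad: False if abcd: "N z = {a, b, c, e}" "distinct [a, b, c, e]"
    and w: "wt z a = 2" "wt z b = 2" "wt z c = 2" "wt z e \<ge> 1" for a b c e
  proof -
    have opt: "\<exists>Q. optional z u Q" if "T u" for u
      using that optional_two two_leg_nbr unfolding T_def by blast
    have D: "\<not> (T p \<and> T q \<and> T r \<and> T v)" and E: "\<not> (G p \<and> one_leg z q \<and> T r \<and> T v)"
      and F: "\<not> (G p \<and> G q \<and> one_leg z r \<and> one_leg z v)"
      if perm: "{a, b, c, e} = {p, q, r, v}" for p q r v
    proof -
      have Nz: "N z = {p, q, r, v}" using perm abcd by simp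
      have dist: "distinct [p, q, r, v]"
        by (rule card_distinct) (use Nz z(2) in simp)
      show "\<not> (T p \<and> T q \<and> T r \<and> T v)"
        using config_two_two_opt_opt[OF z(1) Nz dist] opt[of r] opt[of v] unfolding T_def by blast
      show "\<not> (G p \<and> one_leg z q \<and> T r \<and> T v)"
        using config_good_one_opt_opt[OF z(1) Nz dist] opt[of r] opt[of v] unfolding G_def by blast
      show "\<not> (G p \<and> G q \<and> one_leg z r \<and> one_leg z v)"
        using config_good_good_one_one[OF z(1) Nz dist] two_two_legs unfolding G_def by blast
    qed
    have G: "G u \<and> (T u \<or> one_leg z u)" if "u \<in> N z" "wt z u = 2" for u
      using cs[OF that(1)] that(2) by auto
    have legs: "G a \<and> (T a \<or> one_leg z a)" "G b \<and> (T b \<or> one_leg z b)" "G c \<and> (T c \<or> one_leg z c)"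
      using G[of a] G[of b] G[of c] w abcd(1) by simp_all
    have "wt z e \<noteq> 0" using w(4) by simp
    moreover have "e \<in> N z" using abcd(1) by simp
    ultimately have leg: "G e \<and> T e \<or> one_leg z e" using cs[of e] by auto
    have "{a, b, c, e} = {a, e, b, c}" "{a, b, c, e} = {b, a, c, e}" "{a, b, c, e} = {a, c, b, e}"
      "{a, b, c, e} = {c, e, a, b}" "{a, b, c, e} = {b, e, a, c}" "{a, b, c, e} = {a, e, b, c}"
      "{a, b, c, e} = {b, c, a, e}" "{a, b, c, e} = {a, c, b, e}" by blast+
    note perm = refl[of "{a, b, c, e}"] this
    show False
      using legs leg D[OF perm(1)] E[OF perm(1)] E[OF perm(2)] E[OF perm(3)] E[OF perm(4)]
        F[OF perm(1)] F[OF perm(5)] F[OF perm(6)] F[OF perm(7)] F[OF perm(8)] F[OF perm(9)]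
      by blast
  qed
  show ?thesis
  proof (rule ccontr)
    assume "\<not> ?thesis"
    then have sum: "7 \<le> wt z x + wt z y + wt z s + wt z t" using N by simp
    have "N z = {y, s, t, x}" "N z = {x, s, t, y}" "N z = {x, y, t, s}" using N by auto
    note perm = N(1) this
    have le: "wt z x \<le> 2" "wt z y \<le> 2" "wt z s \<le> 2" "wt z t \<le> 2" by (rule wt_le)+
    consider "wt z x = 2" "wt z y = 2" "wt z s = 2" "wt z t \<ge> 1"
      | "wt z y = 2" "wt z s = 2" "wt z t = 2" "wt z x \<ge> 1"
      | "wt z x = 2" "wt z s = 2" "wt z t = 2" "wt z y \<ge> 1"
      | "wt z x = 2" "wt z y = 2" "wt z t = 2" "wt z s \<ge> 1"
      using sum le by linarith
    then show False
    proof cases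
      case 1
      show ?thesis by (rule bad[OF perm(1) _ 1]) (use N(2) in simp)
    next
      case 2
      show ?thesis by (rule bad[OF perm(2) _ 2]) (use N(2) in auto)
    next
      case 3
      show ?thesis by (rule bad[OF perm(3) _ 3]) (use N(2) in auto)
    next
      case 4
      show ?thesis by (rule bad[OF perm(4) _ 4]) (use N(2) in auto)
    qed
  qed
qed

text \<open>From degree five on, two units per edge are affordable since 2d + 10 is at most 4d;
  smaller degrees rely on the reductions.\<close>

lemma wt_sent:
  assumes "z \<in> U" "3 \<le> d z"
  shows "(\<Sum>x\<in>N z. wt z x) + 10 \<le> 4 * d z"
proof -
  consider "poor z" | "d z = 3" "\<not> poor z" | "d z = 4" | "5 \<le> d z" using assms by linarith
  then show ?thesis
  proof cases
    case 1
    then show ?thesis using wt_sent_poor poor_degree by simp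
  next
    case 4
    have "(\<Sum>x\<in>N z. wt z x) \<le> (\<Sum>x\<in>N z. 2)" by (intro sum_mono wt_le)
    then show ?thesis using 4 by simp
  qed (use assms wt_sent_3 wt_sent_4 in fastforce)+
qed

text \<open>Equivalently, the charges 4d - 10 have nonnegative sum over \<open>U\<close>.\<close>

lemma degree_sum_ge: "5 * card U \<le> 2 * (\<Sum>v\<in>U. d v)"
proof -
  define B where "B = {v \<in> U. 3 \<le> d v}"
  define T where "T = {v \<in> U. d v = 2}"
  have UBT: "U = B \<union> T" "B \<inter> T = {}" "finite B" "finite T"
    using d_ge2 by (auto simp: B_def T_def) (metis le_neq_implies_less not_less_eq_eq numeral_2_eq_2 numeral_3_eq_3 Suc_leI)
  have "2 * card T = (\<Sum>x\<in>T. 2)" by simp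
  also have "\<dots> \<le> (\<Sum>x\<in>T. \<Sum>v | v \<in> B \<and> x \<in> N v. wt v x)"
  proof (rule sum_mono)
    fix x assume x: "x \<in> T"
    have "{v. v \<in> B \<and> x \<in> N v} = {v \<in> N x. 3 \<le> d v}"
      using x N_sym N_subset unfolding B_def T_def by blast
    then show "2 \<le> (\<Sum>v | v \<in> B \<and> x \<in> N v. wt v x)" using wt_received x by (simp add: T_def)
  qed
  \<comment> \<open>Double counting: charge received by vertices of degree two equals charge sent to
    them by branch vertices.\<close>
  also have "\<dots> = (\<Sum>v\<in>B. \<Sum>x | x \<in> T \<and> x \<in> N v. wt v x)"
    using UBT by (intro sum.swap_restrict)
  also have "\<dots> \<le> (\<Sum>v\<in>B. \<Sum>x\<in>N v. wt v x)"
    by (intro sum_mono sum_mono2) auto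
  finally have "2 * card T + 10 * card B \<le> (\<Sum>v\<in>B. \<Sum>x\<in>N v. wt v x) + (\<Sum>v\<in>B. 10)" by simp
  also have "\<dots> = (\<Sum>v\<in>B. (\<Sum>x\<in>N v. wt v x) + 10)" by (simp add: sum.distrib)
  also have "\<dots> \<le> (\<Sum>v\<in>B. 4 * d v)"
    by (intro sum_mono wt_sent) (auto simp: B_def)
  finally have "2 * card T + 10 * card B \<le> 4 * (\<Sum>v\<in>B. d v)" by (simp add: sum_distrib_left)
  moreover have "(\<Sum>v\<in>U. d v) = (\<Sum>v\<in>B. d v) + (\<Sum>v\<in>T. d v)"
    using UBT by (metis sum.union_disjoint)
  moreover have "(\<Sum>v\<in>T. d v) = 2 * card T" by (simp add: T_def)
  moreover have "card U = card B + card T" using UBT by (metis card_Un_disjoint)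
  ultimately show ?thesis by simp
qed

end

section \<open>Theta curves\<close>

text \<open>Used to conclude that the ends of an ear lie on the boundary of the face that contains
  its interior.\<close>

lemma arc_subset_closure:
  assumes "arc g"
  shows "path_image g \<subseteq> closure (path_image g - {pathstart g, pathfinish g})"
proof -
  have sp: "simple_path g" using assms by (rule arc_imp_simple_path)
  have cont: "continuous_on {0..1} g" using assms by (simp add: arc_def path_def)
  have "g ` closure {0<..<1} \<subseteq> closure (g ` {0<..<1})"
    by (rule image_closure_subset) (simp_all add: cont closure_subset)
  then show ?thesis unfolding simple_path_endless[OF sp] by (simp add: path_image_def)
qed

lemma Jordan_two_arcs:
  fixes c1 c2 :: "real \<Rightarrow> complex"
  assumes "arc c1" "pathstart c1 = a" "pathfinish c1 = b"
    and "arc c2" "pathstart c2 = a" "pathfinish c2 = b"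
    and "path_image c1 \<inter> path_image c2 = {a, b}"
  defines "S \<equiv> path_image c1 \<union> path_image c2"
  shows "inside S \<noteq> {}" "connected (inside S)" "connected (outside S)" "frontier (inside S) = S"
    "frontier (outside S) = S"
proof -
  have "simple_path (c1 +++ reversepath c2)"
    using assms by (intro simple_path_join_loop arc_reversepath) auto
  moreover have "pathfinish (c1 +++ reversepath c2) = pathstart (c1 +++ reversepath c2)"
    using assms by simp
  moreover have "path_image (c1 +++ reversepath c2) = S"
    unfolding S_def using assms by (simp add: path_image_join)
  ultimately show "inside S \<noteq> {}" "connected (inside S)" "connected (outside S)" "frontier (inside S) = S"
    "frontier (outside S) = S"
    using Jordan_inside_outside[of "c1 +++ reversepath c2"] by auto
qed

lemma connected_subset_inside:
  assumes "connected D" "D \<inter> S = {}" "p \<in> D" "p \<in> inside S"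
  shows "D \<subseteq> inside S"
proof
  fix x assume "x \<in> D"
  then have "connected_component (- S) p x"
    using assms by (auto simp: connected_component_def)
  then show "x \<in> inside S" using assms(4) inside_same_component by blast
qed

text \<open>The third arc runs outside the closed curve of the first two. A point inside that curve
  must be enclosed by the third arc with one of the first two; the whole inner region is then
  enclosed too, and so is the remaining arc on its frontier.\<close>

lemma theta_outer:
  fixes c1 c2 c :: "real \<Rightarrow> complex"
  assumes c1: "arc c1" "pathstart c1 = a" "pathfinish c1 = b"
    and c2: "arc c2" "pathstart c2 = a" "pathfinish c2 = b"
    and c: "arc c" "pathstart c = a" "pathfinish c = b"
    and I12: "path_image c1 \<inter> path_image c2 = {a, b}"
    and I1: "path_image c1 \<inter> path_image c = {a, b}"
    and I2: "path_image c2 \<inter> path_image c = {a, b}"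
    and out: "path_image c \<inter> inside (path_image c1 \<union> path_image c2) = {}"
  shows "path_image c1 - {a, b} \<subseteq> inside (path_image c2 \<union> path_image c) \<or>
    path_image c2 - {a, b} \<subseteq> inside (path_image c1 \<union> path_image c)"
proof -
  define A B C where "A = path_image c1" and "B = path_image c2" and "C = path_image c"
  note ABC = A_def B_def C_def
  have cpt: "compact A" "compact B" "compact C"
    using c1 c2 c by (auto simp: ABC arc_def compact_path_image)
  \<comment> \<open>The region inside \<open>A \<union> B\<close> is connected and avoids
    \<open>X \<union> C\<close>, so one of its points inside that curve brings in all of it, and its
    closure brings in \<open>Y\<close> except for the ends.\<close>
  have swallow: "Y - {a, b} \<subseteq> inside (X \<union> C)"
    if "X \<union> Y = A \<union> B" "X \<inter> Y = {a, b}" "Y \<inter> C = {a, b}" and p: "p \<in> inside (A \<union> B)" "p \<in> inside (X \<union> C)"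
      and "closed X" for X Y p
  proof -
    have "inside (A \<union> B) \<inter> (X \<union> C) = {}"
      using out that(1) inside_no_overlap[of "A \<union> B"] unfolding ABC by blast
    then have "inside (A \<union> B) \<subseteq> inside (X \<union> C)"
      using connected_subset_inside Jordan_two_arcs(2)[OF c1 c2 I12] p unfolding ABC by blast
    then have "closure (inside (A \<union> B)) \<subseteq> closure (inside (X \<union> C))" by (rule closure_mono)
    moreover have "Y \<subseteq> closure (inside (A \<union> B))"
      using Jordan_two_arcs(4)[OF c1 c2 I12] that(1) unfolding ABC frontier_def by blast
    moreover have "closure (inside (X \<union> C)) \<subseteq> inside (X \<union> C) \<union> (X \<union> C)"
      using closure_inside_subset[of "X \<union> C"] \<open>closed X\<close> cpt(3)
      by (auto simp: compact_imp_closed closed_Un)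
    ultimately show ?thesis using that(2,3) by blast
  qed
  obtain p where p: "p \<in> inside (A \<union> B)"
    using Jordan_two_arcs(1)[OF c1 c2 I12] unfolding ABC by blast
  \<comment> \<open>Otherwise neither \<open>A \<union> C\<close> nor \<open>B \<union> C\<close>
    separates \<open>p\<close> from a remote point. These sets meet in the connected set
    \<open>C\<close>, so by Janiszewski their union does not separate them either, although
    \<open>A \<union> B\<close> does.\<close>
  have "p \<in> inside (A \<union> C) \<or> p \<in> inside (B \<union> C)"
  proof (rule ccontr)
    assume not_in: "\<not> ?thesis"
    have "p \<notin> A \<union> B \<union> C" using p out inside_no_overlap[of "A \<union> B"] unfolding ABC by blast
    then have pout: "p \<in> outside (A \<union> C)" "p \<in> outside (B \<union> C)"
      using not_in by (auto simp: outside_inside)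
    have "bounded (A \<union> B \<union> C)" using cpt by (simp add: compact_imp_bounded)
    then obtain r where "0 < r" and r: "A \<union> B \<union> C \<subseteq> ball 0 r" using bounded_subset_ballD by blast
    define q where "q = complex_of_real r"
    have "q \<in> - ball 0 r" using \<open>0 < r\<close> by (simp add: q_def)
    then have q: "q \<in> outside (A \<union> C)" "q \<in> outside (B \<union> C)" "q \<in> outside (A \<union> B)"
      using r outside_subset_convex[of "ball (0::complex) r"] by (meson convex_ball le_sup_iff subsetD)+
    have comp: "connected_component (- X) p q" if "p \<in> outside X" "q \<in> outside X" "connected (outside X)"
      for X :: "complex set"
      by (rule connected_componentI[OF that(3) _ that(1,2)]) (use outside_no_overlap[of X] in blast)
    have "connected_component (- ((A \<union> C) \<union> (B \<union> C))) p q"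
    proof (rule Janiszewski)
      have "(A \<union> C) \<inter> (B \<union> C) = C" using I12 I1 unfolding ABC by blast
      then show "connected ((A \<union> C) \<inter> (B \<union> C))"
        using c(1) by (simp add: C_def arc_def connected_path_image)
      show "connected_component (- (A \<union> C)) p q"
        using comp pout q Jordan_two_arcs(3)[OF c1 c I1] unfolding ABC by blast
      show "connected_component (- (B \<union> C)) p q"
        using comp pout q Jordan_two_arcs(3)[OF c2 c I2] unfolding ABC by blast
    qed (use cpt in \<open>auto simp: compact_imp_closed closed_Un\<close>)
    then have "connected_component (- (A \<union> B)) p q"
      by (rule connected_component_of_subset) auto
    then have "q \<in> inside (A \<union> B)" using p inside_same_component by blast
    then show False using q(3) inside_Int_outside by blast
  qed
  then show ?thesis
    using swallow[of A B p] swallow[of B A p] p I12 I1 I2 cpt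
    unfolding ABC by (auto simp: compact_imp_closed Int_commute Un_commute)
qed

section \<open>Edge sets of paths and cycles\<close>

fun path_edges :: "'a list \<Rightarrow> 'a set set" where
  "path_edges (u # v # p) = insert {u, v} (path_edges (v # p))"
| "path_edges [u] = {}"
| "path_edges [] = {}"

lemma path_edges_Cons: "p \<noteq> [] \<Longrightarrow> path_edges (u # p) = insert {u, hd p} (path_edges p)"
  by (cases p) auto

lemma path_edges_append: "path_edges (p @ v # q) = path_edges (p @ [v]) \<union> path_edges (v # q)"
proof (induction p)
  case (Cons u p)
  then show ?case by (cases p) auto
qed simp

lemma path_edges_snoc: "p \<noteq> [] \<Longrightarrow> path_edges (p @ [v]) = insert {last p, v} (path_edges p)"
  by (induction p rule: path_edges.induct) auto

lemma path_edges_rev: "path_edges (rev p) = path_edges p"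
proof (induction p rule: path_edges.induct)
  case (1 u v p)
  then show ?case using path_edges_append[of "rev p" v "[u]"] by (auto simp: insert_commute)
qed auto

lemma path_edges_subset: "e \<in> path_edges p \<Longrightarrow> e \<subseteq> set p"
  by (induction p rule: path_edges.induct) auto

lemma Union_path_edges: "2 \<le> length p \<Longrightarrow> \<Union>(path_edges p) = set p"
proof (induction p rule: path_edges.induct)
  case (1 u v p)
  then show ?case by (cases p) auto
qed auto

lemma finite_path_edges [simp]: "finite (path_edges p)"
  by (induction p rule: path_edges.induct) auto

lemma card_path_edges: "distinct p \<Longrightarrow> card (path_edges p) = length p - 1"
proof (induction p rule: path_edges.induct)
  case (1 u v p)
  then have "{u, v} \<notin> path_edges (v # p)" using path_edges_subset[of "{u, v}" "v # p"] by auto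
  then show ?case using 1 by simp
qed auto

lemma path_edges_nth: "Suc i < length p \<Longrightarrow> {p ! i, p ! Suc i} \<in> path_edges p"
proof (induction p arbitrary: i rule: path_edges.induct)
  case (1 u v p)
  then show ?case by (cases i) auto
qed auto

lemma path_edges_ends: "distinct (a # xs @ [b]) \<Longrightarrow> {a, b} \<in> path_edges (a # xs @ [b]) \<Longrightarrow> xs = []"
proof (cases xs)
  case (Cons x xs')
  assume *: "distinct (a # xs @ [b])" "{a, b} \<in> path_edges (a # xs @ [b])"
  then have "{a, b} \<noteq> {a, x}" using Cons by (auto simp: doubleton_eq_iff)
  then have "{a, b} \<in> path_edges (xs @ [b])" using * Cons by simp
  then show ?thesis using path_edges_subset[of "{a, b}" "xs @ [b]"] * by auto
qed simp

lemma path_edges_card2: "distinct p \<Longrightarrow> e \<in> path_edges p \<Longrightarrow> \<exists>u v. e = {u, v} \<and> u \<noteq> v"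
  by (induction p rule: path_edges.induct) auto

text \<open>A common edge can only join \<open>a\<close> and \<open>b\<close>, and then both paths
  consist of that edge.\<close>

lemma path_edges_disjoint:
  assumes "distinct (a # xs @ b # ys)" "xs \<noteq> [] \<or> ys \<noteq> []"
  shows "path_edges (a # xs @ [b]) \<inter> path_edges (a # ys @ [b]) = {}"
proof (rule ccontr)
  assume "\<not> ?thesis"
  then obtain e where e: "e \<in> path_edges (a # xs @ [b])" "e \<in> path_edges (a # ys @ [b])" by blast
  then have "e \<subseteq> {a, b}"
    using path_edges_subset[OF e(1)] path_edges_subset[OF e(2)] assms(1) by auto
  moreover have "\<exists>u v. e = {u, v} \<and> u \<noteq> v"
    by (rule path_edges_card2[OF _ e(1)]) (use assms(1) in auto)
  ultimately have "e = {a, b}" by auto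
  then show False using e assms path_edges_ends[of a xs b] path_edges_ends[of a ys b] by auto
qed

text \<open>Cycles as edge sets forget starting point and direction, so exchanging one of two paths
  between \<open>a\<close> and \<open>b\<close> is a set operation, and the cardinality is the
  length of a face boundary.\<close>

definition cycle_set :: "'a set set \<Rightarrow> bool" where
  "cycle_set C \<longleftrightarrow> (\<exists>c. distinct c \<and> 3 \<le> length c \<and> C = path_edges (c @ [hd c]))"

text \<open>Traverse the second path backwards. The condition on \<open>xs\<close> and
  \<open>ys\<close> rules out one edge run through twice.\<close>

lemma cycle_setI:
  assumes "distinct (a # xs @ b # ys)" "xs \<noteq> [] \<or> ys \<noteq> []"
  shows "cycle_set (path_edges (a # xs @ [b]) \<union> path_edges (a # ys @ [b]))"
proof -
  define c where "c = a # xs @ b # rev ys"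
  have "path_edges (c @ [hd c]) = path_edges (a # xs @ [b]) \<union> path_edges (b # rev ys @ [a])"
    using path_edges_append[of "a # xs" b "rev ys @ [a]"] by (simp add: c_def)
  moreover have "path_edges (b # rev ys @ [a]) = path_edges (a # ys @ [b])"
    using path_edges_rev[of "a # ys @ [b]"] by simp
  moreover have "distinct c" "3 \<le> length c"
    using assms by (auto simp: c_def Suc_le_eq)
  ultimately show ?thesis unfolding cycle_set_def by blast
qed

text \<open>Rotate the cycle so that it starts at \<open>a\<close>, then cut it at \<open>b\<close>
  and reverse the second half.\<close>

lemma cycle_set_split:
  assumes "cycle_set C" "a \<in> \<Union>C" "b \<in> \<Union>C" "a \<noteq> b"
  obtains xs ys where "distinct (a # xs @ b # ys)" "xs \<noteq> [] \<or> ys \<noteq> []"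
    "C = path_edges (a # xs @ [b]) \<union> path_edges (a # ys @ [b])"
proof -
  obtain c where c: "distinct c" "3 \<le> length c" "C = path_edges (c @ [hd c])"
    using assms(1) unfolding cycle_set_def by blast
  have "\<Union>C = set c" using c Union_path_edges[of "c @ [hd c]"] by (cases c) auto
  then obtain p q where pq: "c = p @ a # q" using assms(2) by (metis split_list)
  have C: "C = path_edges (a # q @ p @ [a])"
  proof (cases p)
    case Nil
    then show ?thesis using c pq by simp
  next
    case (Cons x p')
    then show ?thesis
      using c(3) pq path_edges_append[of p a "q @ [x]"] path_edges_append[of "a # q" x "p' @ [a]"] by auto
  qed
  have "b \<in> set (q @ p)" using assms(3,4) \<open>\<Union>C = set c\<close> pq by auto
  then obtain xs ys where xy: "q @ p = xs @ b # ys" by (metis split_list)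
  then have "C = path_edges (a # xs @ b # ys @ [a])" using C by (metis append.assoc append_Cons)
  then have "C = path_edges (a # xs @ [b]) \<union> path_edges (b # ys @ [a])"
    using path_edges_append[of "a # xs" b "ys @ [a]"] by simp
  moreover have "path_edges (b # ys @ [a]) = path_edges (a # rev ys @ [b])"
    using path_edges_rev[of "b # ys @ [a]"] by simp
  moreover have len: "length xs + length ys + 2 = length c" using xy pq
    by (metis (no_types, lifting) add_2_eq_Suc' add_Suc_right length_Cons length_append add.commute)
  then have "xs \<noteq> [] \<or> rev ys \<noteq> []" using c(2) by auto
  moreover have "distinct (a # q @ p)" using c(1) pq by auto
  then have "distinct (a # xs @ b # rev ys)" unfolding xy by simp
  ultimately show ?thesis using that by blast
qed

lemma cycle_set_ends:
  assumes "cycle_set C"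
  obtains a xs b ys where "distinct (a # xs @ b # ys)" "xs \<noteq> [] \<or> ys \<noteq> []"
    "C = path_edges (a # xs @ [b]) \<union> path_edges (a # ys @ [b])"
proof -
  obtain c where c: "distinct c" "3 \<le> length c" "C = path_edges (c @ [hd c])"
    using assms(1) unfolding cycle_set_def by blast
  then obtain a b c' where "c = a # b # c'" by (metis Suc_le_length_iff numeral_3_eq_3)
  moreover from this have "a \<noteq> b" using c(1) by simp
  moreover have "\<Union>C = set c" using c Union_path_edges[of "c @ [hd c]"] by (cases c) auto
  ultimately have "a \<in> \<Union>C" "b \<in> \<Union>C" "a \<noteq> b" by auto
  then show ?thesis using cycle_set_split[OF assms] that by metis
qed

lemma card_two_paths:
  assumes "distinct (a # xs @ b # ys)" "xs \<noteq> [] \<or> ys \<noteq> []"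
  defines "C \<equiv> path_edges (a # xs @ [b]) \<union> path_edges (a # ys @ [b])"
  shows "card C = length xs + length ys + 2" "\<Union>C = {a, b} \<union> set xs \<union> set ys"
    "card (\<Union>C) = card C"
proof -
  show c: "card C = length xs + length ys + 2"
    unfolding C_def using assms(1) path_edges_disjoint[OF assms(1,2)]
    by (subst card_Un_disjoint) (auto simp: card_path_edges)
  show U: "\<Union>C = {a, b} \<union> set xs \<union> set ys"
    unfolding C_def using Union_path_edges[of "a # xs @ [b]"] Union_path_edges[of "a # ys @ [b]"] by auto
  have "\<Union>C = set (a # xs @ b # ys)" using U by auto
  then show "card (\<Union>C) = card C" using c distinct_card[OF assms(1)] by simp
qed

lemma cycle_set_card: "cycle_set C \<Longrightarrow> card (\<Union>C) = card C"
  by (metis cycle_set_ends card_two_paths(3))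

lemma cycle_set_length:
  assumes graph: "simple_graph V E" and C: "cycle_set C" "C \<subseteq> E" and girth: "10 \<le> girth V E"
  shows "10 \<le> card C"
proof -
  obtain c where c: "distinct c" "3 \<le> length c" "C = path_edges (c @ [hd c])"
    using C(1) unfolding cycle_set_def by blast
  have Un: "\<Union>C = set c" using c Union_path_edges[of "c @ [hd c]"] by (cases c) auto
  have "{c ! i, c ! (Suc i mod length c)} \<in> E" if i: "i < length c" for i
  proof -
    have "(c @ [hd c]) ! Suc i = c ! (Suc i mod length c)"
    proof (cases "Suc i = length c")
      case True
      then show ?thesis using c(2) by (cases c) (auto simp: nth_append)
    next
      case False
      then show ?thesis using i by (simp add: nth_append)
    qed
    then show ?thesis
      using path_edges_nth[of i "c @ [hd c]"] i c(3) C(2) by (auto simp: nth_append)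
  qed
  moreover have "set c \<subseteq> V"
    unfolding Un[symmetric] using C(2) graph by (auto simp: simple_graph_def)
  ultimately have "is_cycle V E c" using c by (simp add: is_cycle_def)
  then have "girth V E \<le> enat (length c)" unfolding girth_def by (intro INF_lower) simp
  then have "enat 10 \<le> enat (length c)" using girth order_trans by (metis numeral_eq_enat)
  moreover have "card C = length c" using cycle_set_card[OF C(1)] Un distinct_card[OF c(1)] by simp
  ultimately show ?thesis by simp
qed

section \<open>Faces of plane graphs built from a cycle by adding ears\<close>

locale plane_graph =
  fixes V :: "'a set" and E :: "'a set set" and pos :: "'a \<Rightarrow> complex"
    and \<gamma> :: "'a set \<Rightarrow> real \<Rightarrow> complex"
  assumes graph: "simple_graph V E" and girth: "10 \<le> girth V E"
    and drawing: "plane_drawing V E pos \<gamma>"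
begin

definition K :: "'a set set \<Rightarrow> complex set" where "K F = (\<Union>e\<in>F. path_image (\<gamma> e))"

lemma edge: "e \<in> E \<Longrightarrow> e \<subseteq> V \<and> card e = 2"
  using graph by (auto simp: simple_graph_def)

lemma finite_V [simp]: "finite V"
  using graph by (auto simp: simple_graph_def)

lemma finite_E [simp]: "finite E"
proof (rule finite_subset)
  show "E \<subseteq> Pow V" using edge by auto
qed simp

lemma arc_edge: "e \<in> E \<Longrightarrow> arc (\<gamma> e)"
  using drawing by (auto simp: plane_drawing_def)

lemma K_Un: "K (F \<union> G) = K F \<union> K G"
  by (auto simp: K_def)

lemma K_mono: "F \<subseteq> G \<Longrightarrow> K F \<subseteq> K G"
  by (auto simp: K_def)

lemma closed_K: "F \<subseteq> E \<Longrightarrow> closed (K F)"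
  unfolding K_def using arc_edge finite_subset[OF _ finite_E]
  by (intro compact_imp_closed compact_UN) (auto simp: arc_def intro!: compact_path_image)

lemma inside_K: "F \<subseteq> G \<Longrightarrow> inside (K G) \<inter> K F = {}"
  using inside_no_overlap[of "K G"] K_mono[of F G] by blast

lemma outside_K: "F \<subseteq> G \<Longrightarrow> outside (K G) \<inter> K F = {}"
  using outside_no_overlap[of "K G"] K_mono[of F G] by blast

lemma K_Int:
  assumes "F \<subseteq> E" "G \<subseteq> E" "F \<inter> G = {}"
  shows "K F \<inter> K G \<subseteq> pos ` (\<Union>F \<inter> \<Union>G)"
proof
  fix x assume "x \<in> K F \<inter> K G"
  then obtain e f where ef: "e \<in> F" "f \<in> G" "x \<in> path_image (\<gamma> e)" "x \<in> path_image (\<gamma> f)"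
    by (auto simp: K_def)
  then have "e \<in> E" "f \<in> E" "e \<noteq> f" using assms by auto
  then have "x \<in> pos ` (e \<inter> f)" using drawing ef unfolding plane_drawing_def by blast
  then show "x \<in> pos ` (\<Union>F \<inter> \<Union>G)" using ef by auto
qed

lemma pos_in_K:
  assumes "F \<subseteq> E" "v \<in> V"
  shows "pos v \<in> K F \<longleftrightarrow> v \<in> \<Union>F"
proof
  assume "pos v \<in> K F"
  then obtain e where e: "e \<in> F" "pos v \<in> path_image (\<gamma> e)" by (auto simp: K_def)
  then have "pos v \<in> pos ` e" using drawing assms unfolding plane_drawing_def by blast
  moreover have "inj_on pos V" "e \<subseteq> V" using drawing e assms edge by (auto simp: plane_drawing_def)
  ultimately have "v \<in> e" using assms(2) by (meson inj_on_image_mem_iff)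
  then show "v \<in> \<Union>F" using e by auto
next
  assume "v \<in> \<Union>F"
  then obtain e where e: "e \<in> F" "v \<in> e" by auto
  then have "pos v \<in> path_image (\<gamma> e)" using drawing assms unfolding plane_drawing_def by blast
  then show "pos v \<in> K F" using e by (auto simp: K_def)
qed

lemma edge_arc:
  assumes "{u, v} \<in> E"
  obtains g where "arc g" "pathstart g = pos u" "pathfinish g = pos v" "path_image g = path_image (\<gamma> {u, v})"
proof -
  have g: "arc (\<gamma> {u, v})" "{pathstart (\<gamma> {u, v}), pathfinish (\<gamma> {u, v})} = {pos u, pos v}"
    using drawing assms by (auto simp: plane_drawing_def)
  then consider "pathstart (\<gamma> {u, v}) = pos u" "pathfinish (\<gamma> {u, v}) = pos v"
    | "pathstart (\<gamma> {u, v}) = pos v" "pathfinish (\<gamma> {u, v}) = pos u"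
    by (auto simp: doubleton_eq_iff)
  then show ?thesis
  proof cases
    case 1
    then show ?thesis using that g by blast
  next
    case 2
    show ?thesis
      by (rule that[of "reversepath (\<gamma> {u, v})"]) (use 2 g arc_reversepath in auto)
  qed
qed

lemma path_arc:
  assumes "distinct p" "2 \<le> length p" "path_edges p \<subseteq> E"
  shows "\<exists>g. arc g \<and> pathstart g = pos (hd p) \<and> pathfinish g = pos (last p) \<and> path_image g = K (path_edges p)"
  using assms
proof (induction p rule: path_edges.induct)
  case (1 u v p)
  obtain g where g: "arc g" "pathstart g = pos u" "pathfinish g = pos v" "path_image g = path_image (\<gamma> {u, v})"
    using edge_arc[of u v] "1.prems"(3) by auto
  show ?case
  proof (cases p)
    case Nil
    then show ?thesis using g by (auto simp: K_def)
  next
    case (Cons w q)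
    then obtain h where h: "arc h" "pathstart h = pos v" "pathfinish h = pos (last (v # p))"
      "path_image h = K (path_edges (v # p))" using 1 by auto
    have disj: "{u, v} \<notin> path_edges (v # p)" using path_edges_subset[of "{u, v}" "v # p"] "1.prems"(1) by auto
    have "path_image g \<inter> path_image h = K {{u, v}} \<inter> K (path_edges (v # p))"
      using g h by (simp add: K_def)
    also have "\<dots> \<subseteq> pos ` (\<Union>{{u, v}} \<inter> \<Union>(path_edges (v # p)))"
      by (rule K_Int) (use "1.prems"(3) disj in auto)
    also have "\<dots> \<subseteq> {pos v}"
      using Union_path_edges[of "v # p"] Cons "1.prems"(1) by auto
    finally have "arc (g +++ h)" using g h by (intro arc_join) auto
    then show ?thesis
      using g h Cons by (intro exI[of _ "g +++ h"]) (auto simp: path_image_join K_def)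
  qed
qed auto

text \<open>The curves in \<open>\<F>\<close> bound the inner faces of \<open>H\<close>, and \<open>C\<close> bounds the outer one. The last two conjuncts
  say that every edge lies on two faces, and Euler's formula.\<close>

definition faces :: "'a set set \<Rightarrow> 'a set set set \<Rightarrow> 'a set set \<Rightarrow> bool" where
  "faces H \<F> C \<longleftrightarrow> H \<subseteq> E \<and> finite \<F> \<and> (\<forall>F\<in>insert C \<F>. cycle_set F \<and> F \<subseteq> H) \<and>
    (\<forall>F\<in>\<F>. inside (K F) \<inter> K H = {}) \<and> outside (K C) \<inter> K H = {} \<and>
    (\<forall>F\<in>\<F>. \<forall>F'\<in>\<F>. F \<noteq> F' \<longrightarrow> inside (K F) \<inter> inside (K F') = {}) \<and>
    (\<forall>F\<in>\<F>. inside (K F) \<inter> outside (K C) = {}) \<and>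
    - K H \<subseteq> (\<Union>F\<in>\<F>. inside (K F)) \<union> outside (K C) \<and>
    (\<Sum>F\<in>\<F>. card F) + card C = 2 * card H \<and> card \<F> + card (\<Union>H) = card H + 1"

text \<open>The same curve bounds the inner and the outer face, so its edges are counted
  twice.\<close>

lemma faces_cycle:
  assumes "cycle_set C" "C \<subseteq> E"
  shows "faces C {C} C"
  unfolding faces_def using assms cycle_set_card[OF assms(1)] inside_Un_outside[of "K C"] by auto

text \<open>The \<open>card \<F> + 1\<close> boundaries have at least ten edges each and
  \<open>2 * card H\<close> in total; Euler's formula then eliminates the number of faces.\<close>

lemma faces_bound:
  assumes "faces H \<F> C"
  shows "4 * card H + 10 \<le> 5 * card (\<Union>H)"
proof -
  have "10 \<le> card F" if "F \<in> insert C \<F>" for F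
    using cycle_set_length[OF graph _ _ girth, of F] assms that by (auto simp: faces_def)
  then have "10 \<le> card C" "(\<Sum>F\<in>\<F>. 10) \<le> (\<Sum>F\<in>\<F>. card F)" by (simp, intro sum_mono) simp
  then show ?thesis using assms by (auto simp: faces_def)
qed

lemma two_paths_arcs:
  assumes "distinct (a # xs @ b # ys)"
    and "path_edges (a # xs @ [b]) \<subseteq> E" "path_edges (a # ys @ [b]) \<subseteq> E"
    and "path_edges (a # xs @ [b]) \<inter> path_edges (a # ys @ [b]) = {}"
  shows "K (path_edges (a # xs @ [b])) \<inter> K (path_edges (a # ys @ [b])) = {pos a, pos b}"
proof
  have U: "\<Union>(path_edges (a # xs @ [b])) = {a, b} \<union> set xs" "\<Union>(path_edges (a # ys @ [b])) = {a, b} \<union> set ys"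
    using Union_path_edges[of "a # xs @ [b]"] Union_path_edges[of "a # ys @ [b]"] by auto
  then have "\<Union>(path_edges (a # xs @ [b])) \<inter> \<Union>(path_edges (a # ys @ [b])) = {a, b}"
    using assms(1) by auto
  then show "K (path_edges (a # xs @ [b])) \<inter> K (path_edges (a # ys @ [b])) \<subseteq> {pos a, pos b}"
    using K_Int[OF assms(2-)] by auto
  have "a \<in> V" "b \<in> V" using U(1) assms(2) edge by blast+
  then show "{pos a, pos b} \<subseteq> K (path_edges (a # xs @ [b])) \<inter> K (path_edges (a # ys @ [b]))"
    using pos_in_K[OF assms(2)] pos_in_K[OF assms(3)] U by auto
qed

lemma path_interior:
  fixes a b :: 'a
  assumes "distinct (a # zs @ [b])" and "P = path_edges (a # zs @ [b])" and "P \<subseteq> E"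
  shows "connected (K P - {pos a, pos b})" "K P - {pos a, pos b} \<noteq> {}"
    "K P \<subseteq> closure (K P - {pos a, pos b})"
proof -
  obtain c where c: "arc c" "pathstart c = pos a" "pathfinish c = pos b" "path_image c = K P"
    using path_arc[of "a # zs @ [b]"] assms by auto
  note sp = arc_imp_simple_path[OF c(1)]
  show "connected (K P - {pos a, pos b})" "K P - {pos a, pos b} \<noteq> {}"
    using connected_simple_path_endless[OF sp] nonempty_simple_path_endless[OF sp] c by auto
  show "K P \<subseteq> closure (K P - {pos a, pos b})" using arc_subset_closure[OF c(1)] c by simp
qed

text \<open>The theta curve statements for paths of the drawing: an ear inside a cycle cuts its
  interior in two, and an ear outside encloses one side of the cycle together with the other
  side.\<close>

lemma ear_theta:
  fixes a b :: 'a
  assumes d: "distinct (a # xs @ b # ys @ zs)"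
    and A_def: "A = path_edges (a # xs @ [b])" and B_def: "B = path_edges (a # ys @ [b])"
    and P_def: "P = path_edges (a # zs @ [b])"
    and E: "A \<subseteq> E" "B \<subseteq> E" "P \<subseteq> E" and disj: "A \<inter> B = {}" "A \<inter> P = {}" "B \<inter> P = {}"
  shows "K P - {pos a, pos b} \<subseteq> inside (K (A \<union> B)) \<Longrightarrow>
      inside (K (A \<union> P)) \<inter> inside (K (B \<union> P)) = {} \<and>
      inside (K (A \<union> P)) \<union> inside (K (B \<union> P)) \<union> (K P - {pos a, pos b}) = inside (K (A \<union> B))"
    and "K P \<inter> inside (K (A \<union> B)) = {} \<Longrightarrow>
      K A - {pos a, pos b} \<subseteq> inside (K (B \<union> P)) \<or> K B - {pos a, pos b} \<subseteq> inside (K (A \<union> P))"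
proof -
  obtain c1 where c1: "arc c1" "pathstart c1 = pos a" "pathfinish c1 = pos b" "path_image c1 = K A"
    using path_arc[of "a # xs @ [b]"] E(1) d unfolding A_def by auto
  obtain c2 where c2: "arc c2" "pathstart c2 = pos a" "pathfinish c2 = pos b" "path_image c2 = K B"
    using path_arc[of "a # ys @ [b]"] E(2) d unfolding B_def by auto
  obtain c where c: "arc c" "pathstart c = pos a" "pathfinish c = pos b" "path_image c = K P"
    using path_arc[of "a # zs @ [b]"] E(3) d unfolding P_def by auto
  have "K A \<inter> K B = {pos a, pos b}" "K A \<inter> K P = {pos a, pos b}" "K B \<inter> K P = {pos a, pos b}"
    unfolding A_def B_def P_def
    by (rule two_paths_arcs; use d E disj in \<open>force simp: A_def B_def P_def\<close>)+
  note I = this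
  have sp: "simple_path c1" "simple_path c2" "simple_path c" using c1 c2 c arc_imp_simple_path by blast+
  have ne: "pos a \<noteq> pos b" using c arc_distinct_ends by metis
  have "K P - {pos a, pos b} \<noteq> {}" using nonempty_simple_path_endless[OF sp(3)] c by auto
  show "inside (K (A \<union> P)) \<inter> inside (K (B \<union> P)) = {} \<and>
      inside (K (A \<union> P)) \<union> inside (K (B \<union> P)) \<union> (K P - {pos a, pos b}) = inside (K (A \<union> B))"
    if "K P - {pos a, pos b} \<subseteq> inside (K (A \<union> B))"
  proof -
    have "path_image c \<inter> inside (path_image c1 \<union> path_image c2) \<noteq> {}"
      using that \<open>K P - {pos a, pos b} \<noteq> {}\<close> c1 c2 c by (auto simp: K_Un)
    moreover have "path_image c1 \<inter> path_image c2 = {pos a, pos b}"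
      "path_image c1 \<inter> path_image c = {pos a, pos b}" "path_image c2 \<inter> path_image c = {pos a, pos b}"
      using I c1(4) c2(4) c(4) by simp_all
    ultimately obtain "inside (path_image c1 \<union> path_image c) \<inter> inside (path_image c2 \<union> path_image c) = {}"
      "inside (path_image c1 \<union> path_image c) \<union> inside (path_image c2 \<union> path_image c) \<union>
        (path_image c - {pos a, pos b}) = inside (path_image c1 \<union> path_image c2)"
      using split_inside_simple_closed_curve[OF sp(1) c1(2,3) sp(2) c2(2,3) sp(3) c(2,3) ne] by metis
    then show ?thesis using c1(4) c2(4) c(4) by (simp add: K_Un)
  qed
  show "K A - {pos a, pos b} \<subseteq> inside (K (B \<union> P)) \<or> K B - {pos a, pos b} \<subseteq> inside (K (A \<union> P))"
    if "K P \<inter> inside (K (A \<union> B)) = {}"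
    using theta_outer[OF c1(1-3) c2(1-3) c(1-3)] that I c1(4) c2(4) c(4) by (simp add: K_Un)
qed

text \<open>The interior of the ear is connected and avoids the drawing of \<open>H\<close>, so it
  lies in one face. The ends cut the boundary of that face into two paths, each of which forms a new
  boundary with the ear. The ear adds \<open>length zs\<close> vertices, one edge more than that,
  and one face.\<close>

lemma faces_ear:
  fixes a b :: 'a
  assumes F: "faces H \<F> C" and ear: "distinct (a # zs @ [b])" "a \<in> \<Union>H" "b \<in> \<Union>H" "set zs \<inter> \<Union>H = {}"
    and P: "P = path_edges (a # zs @ [b])" "P \<subseteq> E" "P \<inter> H = {}"
  shows "\<exists>\<F>' C'. faces (H \<union> P) \<F>' C'"
proof -
  define I where "I = K P - {pos a, pos b}"
  note I = path_interior[OF ear(1) P(1,2), folded I_def]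
  have H: "H \<subseteq> E" and finF: "finite \<F>" and cyc: "\<And>G. G \<in> insert C \<F> \<Longrightarrow> cycle_set G \<and> G \<subseteq> H"
    and RH: "\<And>G. G \<in> \<F> \<Longrightarrow> inside (K G) \<inter> K H = {}" and OH: "outside (K C) \<inter> K H = {}"
    and RR: "\<And>G G'. G \<in> \<F> \<Longrightarrow> G' \<in> \<F> \<Longrightarrow> G \<noteq> G' \<Longrightarrow> inside (K G) \<inter> inside (K G') = {}"
    and RO: "\<And>G. G \<in> \<F> \<Longrightarrow> inside (K G) \<inter> outside (K C) = {}"
    and cover: "- K H \<subseteq> (\<Union>G\<in>\<F>. inside (K G)) \<union> outside (K C)"
    and sum: "(\<Sum>G\<in>\<F>. card G) + card C = 2 * card H" and euler: "card \<F> + card (\<Union>H) = card H + 1"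
    using F unfolding faces_def by auto
  have finH: "finite H" and finP: "finite P" using H finite_subset[OF _ finite_E] P by auto
  have UP: "\<Union>P = {a, b} \<union> set zs" using Union_path_edges[of "a # zs @ [b]"] P(1) by auto
  have ab: "a \<noteq> b" "a \<in> V" "b \<in> V" using ear H edge by auto
  have posH: "pos a \<in> K H" "pos b \<in> K H" using pos_in_K[OF H] ab ear by auto
  have posP: "pos a \<in> K P" "pos b \<in> K P" using pos_in_K[OF P(2)] ab UP by auto
  have "\<Union>P \<inter> \<Union>H \<subseteq> {a, b}" using UP ear(4) by auto
  then have "K P \<inter> K H \<subseteq> pos ` {a, b}" by (rule order_trans[OF K_Int[OF P(2) H P(3)] image_mono])
  then have IH: "I \<inter> K H = {}" by (auto simp: I_def)
  have KP: "K P = insert (pos a) (insert (pos b) I)" using posP by (auto simp: I_def)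
  have card_UP: "card (\<Union>(H \<union> P)) = card (\<Union>H) + length zs"
  proof -
    have "\<Union>(H \<union> P) = \<Union>H \<union> set zs" using UP ear by auto
    moreover have "finite (\<Union>H)" using H edge finite_subset[OF _ finite_V, of "\<Union>H"] by auto
    ultimately show ?thesis using ear by (simp add: card_Un_disjoint Int_commute distinct_card)
  qed
  have card_P: "card P = length zs + 1" using card_path_edges[OF ear(1)] P(1) by simp
  have card_HP: "card (H \<union> P) = card H + card P" using finH finP P(3) by (simp add: card_Un_disjoint Int_commute)
  have open_R: "open (inside (K G))" if "G \<in> insert C \<F>" for G
    using cyc[OF that] H closed_K[of G] open_inside by blast
  have "C \<subseteq> E" using cyc[of C] H by auto
  then have open_O: "open (outside (K C))" using closed_K open_outside by blast
  \<comment> \<open>\<open>R\<close> is the face containing the ear and \<open>G\<close> its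
    boundary. The ends of the ear lie in the closure of \<open>R\<close> but on the drawing of
    \<open>H\<close>, hence on \<open>G\<close>.\<close>
  have split: "\<exists>xs ys. distinct (a # xs @ b # ys @ zs) \<and> path_edges (a # xs @ [b]) \<inter> path_edges (a # ys @ [b]) = {} \<and>
      G = path_edges (a # xs @ [b]) \<union> path_edges (a # ys @ [b])"
    if G: "G \<in> insert C \<F>" and R: "I \<subseteq> R" "closure R \<subseteq> R \<union> K G" "R \<inter> K H = {}" for G R
  proof -
    have "K P \<subseteq> R \<union> K G" using I(3) closure_mono[OF R(1)] R(2) by blast
    then have "pos a \<in> K G" "pos b \<in> K G" using posH posP R(3) by auto
    moreover have GE: "G \<subseteq> E" using cyc[OF G] H by auto
    ultimately have "a \<in> \<Union>G" "b \<in> \<Union>G" using pos_in_K[OF GE ab(2)] pos_in_K[OF GE ab(3)] by simp_all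
    then obtain xs ys where xy: "distinct (a # xs @ b # ys)" "xs \<noteq> [] \<or> ys \<noteq> []"
      "G = path_edges (a # xs @ [b]) \<union> path_edges (a # ys @ [b])"
      using cycle_set_split[of G a b] cyc[OF G] ab(1) by metis
    have "\<Union>G = {a, b} \<union> set xs \<union> set ys" using card_two_paths(2)[OF xy(1,2)] xy(3) by simp
    moreover have "\<Union>G \<subseteq> \<Union>H" using cyc[OF G] by blast
    ultimately have "set zs \<inter> (set xs \<union> set ys) = {}" using ear(4) by blast
    then have "distinct (a # xs @ b # ys @ zs)" using xy(1) ear(1) by auto
    then show ?thesis using xy path_edges_disjoint[OF xy(1,2)] by blast
  qed
  \<comment> \<open>\<open>xs\<close> and \<open>zs\<close> cannot both be empty, because the edge
    joining \<open>a\<close> and \<open>b\<close> would then belong to both \<open>H\<close> and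
    \<open>P\<close>. As \<open>P\<close> is disjoint from \<open>H\<close>, the new cycle is no old
    boundary.\<close>
  have new: "cycle_set (A \<union> P) \<and> card (A \<union> P) = card A + card P \<and> A \<union> P \<notin> \<F>"
    if A: "A = path_edges (a # xs @ [b])" "A \<subseteq> H" "distinct (a # xs @ b # zs)" for A xs
  proof (intro conjI)
    have "xs \<noteq> [] \<or> zs \<noteq> []" using A P by auto
    then show "cycle_set (A \<union> P)" unfolding A(1) P(1) by (rule cycle_setI[OF A(3)])
    have "A \<inter> P = {}" using A(2) P(3) by auto
    then show "card (A \<union> P) = card A + card P" using A(1) finP by (simp add: card_Un_disjoint)
    have "P \<noteq> {}" using card_P by auto
    then have "\<not> A \<union> P \<subseteq> H" using P(3) by auto
    then show "A \<union> P \<notin> \<F>" using cyc[of "A \<union> P"] by auto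
  qed
  \<comment> \<open>The faces are open and disjoint and cover \<open>I\<close>, so a connected
    \<open>I\<close> cannot meet two of them.\<close>
  have "(\<exists>G\<in>\<F>. I \<subseteq> inside (K G)) \<or> I \<subseteq> outside (K C)"
  proof (cases "I \<inter> outside (K C) = {}")
    case False
    have "open (\<Union>G\<in>\<F>. inside (K G))" using open_R by auto
    moreover have "outside (K C) \<inter> (\<Union>G\<in>\<F>. inside (K G)) \<inter> I = {}" using RO by blast
    moreover have "I \<subseteq> outside (K C) \<union> (\<Union>G\<in>\<F>. inside (K G))" using cover IH by blast
    ultimately have "(\<Union>G\<in>\<F>. inside (K G)) \<inter> I = {}" using connectedD[OF I(1) open_O] False by blast
    then show ?thesis using cover IH by blast
  next
    case True
    then obtain x where "x \<in> I" "x \<in> (\<Union>G\<in>\<F>. inside (K G))" using I(2) cover IH by blast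
    then obtain G where G: "G \<in> \<F>" "x \<in> I" "x \<in> inside (K G)" by blast
    define R where "R = (\<Union>F\<in>\<F> - {G}. inside (K F)) \<union> outside (K C)"
    have "open R" using open_R open_O unfolding R_def by auto
    moreover have "inside (K G) \<inter> R \<inter> I = {}" using RO RR G(1) unfolding R_def by blast
    moreover have "I \<subseteq> inside (K G) \<union> R" using cover IH unfolding R_def by blast
    ultimately have "R \<inter> I = {}" using connectedD[OF I(1) open_R] G by blast
    then have "I \<subseteq> inside (K G)" using \<open>I \<subseteq> inside (K G) \<union> R\<close> by blast
    then show ?thesis using G(1) by blast
  qed
  then show ?thesis
  proof
    assume "\<exists>G\<in>\<F>. I \<subseteq> inside (K G)"
    then obtain G where G: "G \<in> \<F>" "I \<subseteq> inside (K G)" by blast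
    have GE: "G \<subseteq> E" using cyc[of G] G(1) H by auto
    have "closure (inside (K G)) \<subseteq> inside (K G) \<union> K G"
      using closure_inside_subset[OF closed_K[OF GE]] by blast
    then obtain xs ys where xy: "distinct (a # xs @ b # ys @ zs)"
      "path_edges (a # xs @ [b]) \<inter> path_edges (a # ys @ [b]) = {}"
      "G = path_edges (a # xs @ [b]) \<union> path_edges (a # ys @ [b])"
      using split[of G "inside (K G)"] G RH by blast
    define A B where "A = path_edges (a # xs @ [b])" and "B = path_edges (a # ys @ [b])"
    have GAB: "G = A \<union> B" "A \<inter> B = {}" using xy A_def B_def by auto
    have AB: "A \<subseteq> H" "B \<subseteq> H" using cyc[of G] G(1) GAB by auto
    have newA: "cycle_set (A \<union> P) \<and> card (A \<union> P) = card A + card P \<and> A \<union> P \<notin> \<F>"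
      by (rule new[OF A_def AB(1)]) (use xy(1) in auto)
    have newB: "cycle_set (B \<union> P) \<and> card (B \<union> P) = card B + card P \<and> B \<union> P \<notin> \<F>"
      by (rule new[OF B_def AB(2)]) (use xy(1) in auto)
    have "A \<noteq> {}" unfolding A_def by (cases xs) auto
    then have ne: "A \<union> P \<noteq> B \<union> P" using GAB AB P(3) by blast
    have theta: "inside (K (A \<union> P)) \<inter> inside (K (B \<union> P)) = {} \<and>
        inside (K (A \<union> P)) \<union> inside (K (B \<union> P)) \<union> I = inside (K G)"
    proof -
      have "A \<subseteq> E" "B \<subseteq> E" using AB H by blast+
      moreover have "A \<inter> P = {}" "B \<inter> P = {}" using AB P(3) by blast+
      moreover have "K P - {pos a, pos b} \<subseteq> inside (K (A \<union> B))" using G(2) unfolding I_def GAB(1) .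
      ultimately show ?thesis
        unfolding I_def GAB(1) by (intro ear_theta(1)[OF xy(1) A_def B_def P(1)] P(2) GAB(2))
    qed
    have over: "inside (K (A \<union> P)) \<inter> K P = {}" "inside (K (B \<union> P)) \<inter> K P = {}"
      by (rule inside_K; simp)+
    define \<F>' where "\<F>' = insert (A \<union> P) (insert (B \<union> P) (\<F> - {G}))"
    have in_F': "X = A \<union> P \<or> X = B \<union> P \<or> X \<in> \<F> \<and> X \<noteq> G" if "X \<in> \<F>'" for X
      using that by (auto simp: \<F>'_def)
    have sub: "inside (K (A \<union> P)) \<subseteq> inside (K G)" "inside (K (B \<union> P)) \<subseteq> inside (K G)" using theta by blast+
    have "faces (H \<union> P) \<F>' C"
      unfolding faces_def
    proof (intro conjI ballI impI)
      show "H \<union> P \<subseteq> E" "finite \<F>'" using H P finF by (auto simp: \<F>'_def)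
    next
      fix X assume "X \<in> insert C \<F>'"
      then show "cycle_set X" "X \<subseteq> H \<union> P" using cyc[of X] newA newB AB by (auto simp: \<F>'_def)
    next
      fix X assume X: "X \<in> \<F>'"
      show "inside (K X) \<inter> K (H \<union> P) = {}"
      proof (cases "X \<in> \<F> \<and> X \<noteq> G")
        case True
        then have "inside (K X) \<inter> K H = {}" "inside (K X) \<inter> inside (K G) = {}" using RH[of X] RR[of X G] G(1) by auto
        then show ?thesis using G(2) posH unfolding K_Un KP by blast
      next
        case False
        then have "inside (K X) \<subseteq> inside (K G)" "inside (K X) \<inter> K P = {}" using in_F'[OF X] over sub by auto
        then show ?thesis using RH[OF G(1)] unfolding K_Un by blast
      qed
      show "inside (K X) \<inter> outside (K C) = {}"
      proof (cases "X \<in> \<F> \<and> X \<noteq> G")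
        case False
        then have "inside (K X) \<subseteq> inside (K G)" using in_F'[OF X] sub by auto
        then show ?thesis using RO[OF G(1)] by blast
      qed (use RO[of X] in auto)
      fix Y assume Y: "Y \<in> \<F>'" "X \<noteq> Y"
      have other: "inside (K Z) \<inter> inside (K G) = {}" if "Z \<in> \<F> \<and> Z \<noteq> G" for Z
        using RR[of Z G] that G(1) by auto
      have inG: "inside (K Z) \<subseteq> inside (K G)" if "Z = A \<union> P \<or> Z = B \<union> P" for Z
        using that sub by auto
      show "inside (K X) \<inter> inside (K Y) = {}"
      proof (cases "X \<in> \<F> \<and> X \<noteq> G"; cases "Y \<in> \<F> \<and> Y \<noteq> G")
        assume XY: "X \<in> \<F> \<and> X \<noteq> G" "Y \<in> \<F> \<and> Y \<noteq> G"
        then show ?thesis using RR[of X Y] Y(2) by auto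
      next
        assume XY: "X \<in> \<F> \<and> X \<noteq> G" "\<not> (Y \<in> \<F> \<and> Y \<noteq> G)"
        then have "Y = A \<union> P \<or> Y = B \<union> P" using in_F'[OF Y(1)] by blast
        then show ?thesis using other[OF XY(1)] inG[of Y] by auto
      next
        assume XY: "\<not> (X \<in> \<F> \<and> X \<noteq> G)" "Y \<in> \<F> \<and> Y \<noteq> G"
        then have "X = A \<union> P \<or> X = B \<union> P" using in_F'[OF X] by blast
        then show ?thesis using other[OF XY(2)] inG[of X] by auto
      next
        assume XY: "\<not> (X \<in> \<F> \<and> X \<noteq> G)" "\<not> (Y \<in> \<F> \<and> Y \<noteq> G)"
        have "X = A \<union> P \<or> X = B \<union> P" using in_F'[OF X] XY(1) by blast
        moreover have "Y = A \<union> P \<or> Y = B \<union> P" using in_F'[OF Y(1)] XY(2) by blast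
        ultimately show ?thesis using Y(2) theta by (elim disjE) (simp_all add: Int_commute)
      qed
    next
      show "outside (K C) \<inter> K (H \<union> P) = {}" using OH RO[OF G(1)] G(2) posH unfolding K_Un KP by blast
    next
      show "- K (H \<union> P) \<subseteq> (\<Union>F\<in>\<F>'. inside (K F)) \<union> outside (K C)"
      proof
        fix x assume "x \<in> - K (H \<union> P)"
        then have x: "x \<notin> K H" "x \<notin> I" unfolding K_Un KP by auto
        then consider F where "F \<in> \<F>" "x \<in> inside (K F)" | "x \<in> outside (K C)" using cover by blast
        then show "x \<in> (\<Union>F\<in>\<F>'. inside (K F)) \<union> outside (K C)"
        proof cases
          case 1
          then show ?thesis using theta x(2) by (cases "F = G") (auto simp: \<F>'_def)
        qed simp
      qed
    next
      have "(\<Sum>F\<in>\<F>. card F) = card G + (\<Sum>F\<in>\<F> - {G}. card F)" using finF G(1) by (simp add: sum.remove)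
      moreover have "card G = card A + card B" using GAB finH AB by (simp add: card_Un_disjoint finite_subset)
      moreover have "(\<Sum>F\<in>\<F>'. card F) = card (A \<union> P) + (card (B \<union> P) + (\<Sum>F\<in>\<F> - {G}. card F))"
        unfolding \<F>'_def using finF newA newB ne by (subst sum.insert; simp)+
      ultimately show "(\<Sum>F\<in>\<F>'. card F) + card C = 2 * card (H \<union> P)" using newA newB sum card_HP by simp
      have "card \<F> \<noteq> 0" using G(1) finF by auto
      moreover have "card \<F>' = Suc (Suc (card \<F> - 1))"
        unfolding \<F>'_def using finF newA newB ne G(1) by simp
      ultimately show "card \<F>' + card (\<Union>(H \<union> P)) = card (H \<union> P) + 1"
        using euler card_HP card_P card_UP by simp
    qed
    then show ?thesis by blast
  next
    assume IO: "I \<subseteq> outside (K C)"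
    have CE: "C \<subseteq> E" by fact
    have "closure (outside (K C)) \<subseteq> outside (K C) \<union> K C"
      using closure_outside_subset[OF closed_K[OF CE]] by blast
    then obtain xs ys where xy: "distinct (a # xs @ b # ys @ zs)"
      "path_edges (a # xs @ [b]) \<inter> path_edges (a # ys @ [b]) = {}"
      "C = path_edges (a # xs @ [b]) \<union> path_edges (a # ys @ [b])"
      using split[of C "outside (K C)"] IO OH by blast
    \<comment> \<open>Stated for arbitrary halves of \<open>C\<close>, because either half may be
      the enclosed one. With \<open>B\<close> enclosed, \<open>A \<union> P\<close> becomes the
      outer boundary and \<open>B \<union> P\<close> bounds a new inner face.\<close>
    have main: "\<exists>\<F>' C'. faces (H \<union> P) \<F>' C'"
      if d: "distinct (a # xs @ b # ys @ zs)" and AB: "A = path_edges (a # xs @ [b])" "B = path_edges (a # ys @ [b])"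
        "C = A \<union> B" "A \<inter> B = {}" and sw: "K B - {pos a, pos b} \<subseteq> inside (K (A \<union> P))" for xs ys A B
    proof -
      have ABH: "A \<subseteq> H" "B \<subseteq> H" using cyc[of C] AB(3) by auto
      have newA: "cycle_set (A \<union> P) \<and> card (A \<union> P) = card A + card P \<and> A \<union> P \<notin> \<F>"
        by (rule new[OF AB(1) ABH(1)]) (use d in auto)
      have newB: "cycle_set (B \<union> P) \<and> card (B \<union> P) = card B + card P \<and> B \<union> P \<notin> \<F>"
        by (rule new[OF AB(2) ABH(2)]) (use d in auto)
      \<comment> \<open>The roles of \<open>B\<close> and \<open>P\<close> are exchanged: now
        \<open>B\<close> is the arc that cuts the interior of \<open>A \<union> P\<close>, into the
        interior of \<open>C\<close> and the new face.\<close>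
      have d': "distinct (a # xs @ b # zs @ ys)" using d by auto
      have theta: "inside (K (A \<union> B)) \<inter> inside (K (P \<union> B)) = {} \<and>
          inside (K (A \<union> B)) \<union> inside (K (P \<union> B)) \<union> (K B - {pos a, pos b}) = inside (K (A \<union> P))"
      proof -
        have "A \<subseteq> E" "B \<subseteq> E" using ABH H by blast+
        moreover have "A \<inter> P = {}" "P \<inter> B = {}" using ABH P(3) by blast+
        ultimately show ?thesis by (intro ear_theta(1)[OF d' AB(1) P(1) AB(2)] P(2) AB(4) sw)
      qed
      then have theta: "inside (K C) \<inter> inside (K (B \<union> P)) = {}"
          "inside (K C) \<union> inside (K (B \<union> P)) \<union> (K B - {pos a, pos b}) = inside (K (A \<union> P))"
        using AB(3) by (simp_all add: Un_commute)
      define S where "S = inside (K (B \<union> P))"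
      have S: "S \<inter> K B = {}" "S \<inter> K P = {}"
        unfolding S_def by (rule inside_K; simp)+
      have S': "S \<inter> inside (K C) = {}" "S \<subseteq> inside (K (A \<union> P))" using theta unfolding S_def by blast+
      have SA: "S \<inter> K A = {}" using S'(2) inside_K[of A "A \<union> P"] by blast
      have "K H \<subseteq> K C \<union> inside (K C)" using OH union_with_inside[of "K C"] by blast
      then have HC: "K H \<subseteq> K A \<union> K B \<union> inside (K C)" unfolding AB(3) K_Un .
      have OA: "outside (K (A \<union> P)) \<inter> inside (K (A \<union> P)) = {}"
        using inside_Int_outside[of "K (A \<union> P)"] by blast
      have OA': "outside (K (A \<union> P)) \<inter> K A = {}" "outside (K (A \<union> P)) \<inter> K P = {}"
        by (rule outside_K; simp)+
      \<comment> \<open>An inner face avoids both \<open>C\<close> and its outside.\<close>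
      have inC: "inside (K F) \<subseteq> inside (K C)" if "F \<in> \<F>" for F
      proof -
        have "inside (K F) \<inter> K C = {}" using RH[OF that] K_mono cyc[of C] by blast
        then show ?thesis using RO[OF that] union_with_outside[of "K C"] by blast
      qed
      have inCA: "inside (K C) \<subseteq> inside (K (A \<union> P))" using theta by blast
      have posA: "pos a \<in> K A" "pos b \<in> K A"
      proof -
        have "\<Union>A = {a, b} \<union> set xs" using Union_path_edges[of "a # xs @ [b]"] AB(1) by auto
        then show "pos a \<in> K A" "pos b \<in> K A" using pos_in_K[of A] ABH(1) H ab by auto
      qed
      define \<F>' where "\<F>' = insert (B \<union> P) \<F>"
      have in_F': "inside (K X) = S \<or> X \<in> \<F>" if "X \<in> \<F>'" for X
        using that by (auto simp: \<F>'_def S_def)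
      have "faces (H \<union> P) \<F>' (A \<union> P)"
        unfolding faces_def
      proof (intro conjI ballI impI)
        show "H \<union> P \<subseteq> E" "finite \<F>'" using H P finF by (auto simp: \<F>'_def)
      next
        fix X assume "X \<in> insert (A \<union> P) \<F>'"
        then show "cycle_set X" "X \<subseteq> H \<union> P" using cyc[of X] newA newB ABH by (auto simp: \<F>'_def)
      next
        fix X assume X: "X \<in> \<F>'"
        have "S \<inter> K H = {}" using S S' SA HC by blast
        then have SHP: "S \<inter> K (H \<union> P) = {}" using S(2) unfolding K_Un by blast
        have old: "inside (K X) \<inter> K (H \<union> P) = {}" if "X \<in> \<F>"
          using RH[OF that] RO[OF that] IO posH unfolding K_Un KP by blast
        show "inside (K X) \<inter> K (H \<union> P) = {}" using in_F'[OF X] SHP old by auto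
        have "inside (K X) \<subseteq> inside (K (A \<union> P))" using in_F'[OF X] S'(2) inC[of X] inCA by auto
        then show "inside (K X) \<inter> outside (K (A \<union> P)) = {}" using OA by blast
        fix Y assume Y: "Y \<in> \<F>'" "X \<noteq> Y"
        consider "X = B \<union> P" "Y \<in> \<F>" | "Y = B \<union> P" "X \<in> \<F>" | "X \<in> \<F>" "Y \<in> \<F>"
          using X Y by (auto simp: \<F>'_def)
        then show "inside (K X) \<inter> inside (K Y) = {}"
        proof cases
          case 1
          then show ?thesis using inC[OF 1(2)] theta(1) by blast
        next
          case 2
          then show ?thesis using inC[OF 2(2)] theta(1) by blast
        next
          case 3
          then show ?thesis using RR[of X Y] Y(2) by auto
        qed
      next
        show "outside (K (A \<union> P)) \<inter> K (H \<union> P) = {}"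
          using HC OA OA' inCA sw posA unfolding K_Un[of H P] by blast
      next
        show "- K (H \<union> P) \<subseteq> (\<Union>F\<in>\<F>'. inside (K F)) \<union> outside (K (A \<union> P))"
        proof
          fix x assume "x \<in> - K (H \<union> P)"
          then have x: "x \<notin> K H" "x \<notin> K P" unfolding K_Un by auto
          then consider F where "F \<in> \<F>" "x \<in> inside (K F)" | "x \<in> outside (K C)" using cover by blast
          then show "x \<in> (\<Union>F\<in>\<F>'. inside (K F)) \<union> outside (K (A \<union> P))"
          proof cases
            case 1
            then show ?thesis by (auto simp: \<F>'_def)
          next
            case 2
            have "x \<notin> K A" "x \<notin> K B" using x(1) K_mono ABH by blast+
            then have "x \<notin> K (A \<union> P)" using x(2) by (simp add: K_Un)
            then have "x \<in> outside (K (A \<union> P)) \<or> x \<in> inside (K (A \<union> P))"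
              using union_with_inside[of "K (A \<union> P)"] by blast
            moreover have "x \<notin> inside (K C)" using 2 inside_Int_outside by blast
            ultimately have "x \<in> outside (K (A \<union> P)) \<or> x \<in> inside (K (B \<union> P))"
              using theta(2) \<open>x \<notin> K B\<close> by blast
            then show ?thesis by (auto simp: \<F>'_def)
          qed
        qed
      next
        have "card C = card A + card B" using AB finH ABH by (simp add: card_Un_disjoint)
        moreover have "(\<Sum>F\<in>\<F>'. card F) = card (B \<union> P) + (\<Sum>F\<in>\<F>. card F)"
          unfolding \<F>'_def using finF newB by simp
        ultimately show "(\<Sum>F\<in>\<F>'. card F) + card (A \<union> P) = 2 * card (H \<union> P)" using newA newB sum card_HP by simp
        have "card \<F>' = Suc (card \<F>)" unfolding \<F>'_def using finF newB by simp
        then show "card \<F>' + card (\<Union>(H \<union> P)) = card (H \<union> P) + 1"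
          using euler card_HP card_P card_UP by simp
      qed
      then show ?thesis by blast
    qed
    define A B where "A = path_edges (a # xs @ [b])" and "B = path_edges (a # ys @ [b])"
    have CAB: "C = A \<union> B" "A \<inter> B = {}" using xy A_def B_def by auto
    have ABH: "A \<subseteq> H" "B \<subseteq> H" using cyc[of C] CAB by auto
    have "K P \<inter> inside (K C) = {}"
    proof -
      have "pos a \<in> K C" "pos b \<in> K C"
        using pos_in_K[OF CE] ab card_two_paths(2)[of a xs b ys] xy
          Union_path_edges[of "a # xs @ [b]"] by auto
      then show ?thesis
        using IO inside_Int_outside[of "K C"] inside_no_overlap[of "K C"] unfolding KP by blast
    qed
    then have "K P \<inter> inside (K (A \<union> B)) = {}" unfolding CAB(1) .
    moreover have "A \<subseteq> E" "B \<subseteq> E" using ABH H by blast+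
    moreover have "A \<inter> P = {}" "B \<inter> P = {}" using ABH P(3) by blast+
    ultimately have "K A - {pos a, pos b} \<subseteq> inside (K (B \<union> P)) \<or> K B - {pos a, pos b} \<subseteq> inside (K (A \<union> P))"
      by (intro ear_theta(2)[OF xy(1) A_def B_def P(1)] P(2) CAB(2))
    then show ?thesis
    proof
      assume "K B - {pos a, pos b} \<subseteq> inside (K (A \<union> P))"
      then show ?thesis by (rule main[OF xy(1) A_def B_def CAB])
    next
      assume *: "K A - {pos a, pos b} \<subseteq> inside (K (B \<union> P))"
      have "distinct (a # ys @ b # xs @ zs)" using xy(1) by auto
      moreover have "C = B \<union> A" "B \<inter> A = {}" using CAB by auto
      ultimately show ?thesis by (intro main[OF _ B_def A_def _ _ *])
    qed
  qed
qed

end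

section \<open>Few edges\<close>

lemma shorten_walk:
  assumes "w \<noteq> []"
  shows "\<exists>p. p \<noteq> [] \<and> distinct p \<and> hd p = hd w \<and> last p = last w \<and> set p \<subseteq> set w \<and>
    path_edges p \<subseteq> path_edges w"
  using assms
proof (induction w)
  case (Cons u w)
  show ?case
  proof (cases "w = []")
    case True
    then show ?thesis by (intro exI[of _ "[u]"]) auto
  next
    case False
    then obtain p where p: "p \<noteq> []" "distinct p" "hd p = hd w" "last p = last w" "set p \<subseteq> set w"
      "path_edges p \<subseteq> path_edges w" using Cons.IH by blast
    show ?thesis
    proof (cases "u \<in> set p")
      case True
      then obtain q r where "p = q @ u # r" by (metis split_list)
      then show ?thesis using p False path_edges_append[of q u r]
        by (intro exI[of _ "u # r"]) (auto simp: path_edges_Cons)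
    next
      case False
      then show ?thesis using p \<open>w \<noteq> []\<close>
        by (intro exI[of _ "u # p"]) (auto simp: path_edges_Cons)
    qed
  qed
qed simp

text \<open>The component of \<open>x\<close> in the subgraph induced on \<open>X\<close>.\<close>

definition reachable :: "'a set set \<Rightarrow> 'a set \<Rightarrow> 'a \<Rightarrow> 'a set" where
  "reachable E X x = {y. \<exists>w. w \<noteq> [] \<and> hd w = x \<and> last w = y \<and> set w \<subseteq> X \<and> path_edges w \<subseteq> E}"

lemma reachable_refl: "x \<in> X \<Longrightarrow> x \<in> reachable E X x"
  unfolding reachable_def by (auto intro!: exI[of _ "[x]"])

lemma reachable_subset: "reachable E X x \<subseteq> X"
  unfolding reachable_def using last_in_set by fastforce

lemma reachable_step:
  assumes "y \<in> reachable E X x" "z \<in> X" "{y, z} \<in> E"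
  shows "z \<in> reachable E X x"
proof -
  obtain w where w: "w \<noteq> []" "hd w = x" "last w = y" "set w \<subseteq> X" "path_edges w \<subseteq> E"
    using assms(1) unfolding reachable_def by blast
  then show ?thesis
    using assms unfolding reachable_def
    by (auto simp: path_edges_snoc intro!: exI[of _ "w @ [z]"])
qed

text \<open>Go back to \<open>x\<close>, continue to \<open>z\<close>, and shorten the resulting
  walk to a path.\<close>

lemma reachable_path:
  assumes "y \<in> reachable E X x" "z \<in> reachable E X x"
  shows "\<exists>p. p \<noteq> [] \<and> distinct p \<and> hd p = y \<and> last p = z \<and> set p \<subseteq> X \<and> path_edges p \<subseteq> E"
proof -
  obtain v where v: "v \<noteq> []" "hd v = x" "last v = y" "set v \<subseteq> X" "path_edges v \<subseteq> E"
    using assms(1) unfolding reachable_def by blast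
  obtain w where w: "w \<noteq> []" "hd w = x" "last w = z" "set w \<subseteq> X" "path_edges w \<subseteq> E"
    using assms(2) unfolding reachable_def by blast
  obtain v' w' where vw: "v = x # v'" "w = x # w'" using v w by (metis list.collapse)
  define u where "u = rev v' @ x # w'"
  have "path_edges u = path_edges v \<union> path_edges w"
    using path_edges_append[of "rev v'" x w'] path_edges_rev[of v] vw by (simp add: u_def)
  moreover have "u \<noteq> []" "hd u = y" "last u = z" "set u \<subseteq> X"
    using v w vw by (auto simp: u_def hd_append last_rev hd_rev split: if_splits)
  ultimately show ?thesis using shorten_walk[of u] v w by (metis Un_least subset_trans)
qed

context plane_graph
begin

text \<open>The constant 5 is the one that survives gluing at a vertex: two parts sharing a vertex
  have one vertex more in total than their union, which costs 5, while their two bounds contribute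
  10. It is attained by a single vertex.\<close>

lemma edge_bound:
  assumes "U \<subseteq> V" "U \<noteq> {}"
  shows "4 * card {e \<in> E. e \<subseteq> U} + 5 \<le> 5 * card U"
  using assms
proof (induction "card U" arbitrary: U rule: less_induct)
  case less
  define EU where "EU = (\<lambda>X. {e \<in> E. e \<subseteq> X})"
  have finU: "finite U" using less.prems finite_subset finite_V by blast
  have fin: "finite (EU X)" for X by (simp add: EU_def)
  have two: "\<exists>u v. e = {u, v} \<and> u \<noteq> v" if "e \<in> E" for e
    using edge[OF that] by (meson card_2_iff)
  have IH: "4 * card (EU X) + 5 \<le> 5 * card X" if "X \<subset> U" "X \<noteq> {}" for X
    unfolding EU_def using less.hyps[of X] that less.prems finU psubset_card_mono by (metis psubset_imp_subset subset_trans)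
  show ?case
  proof (cases "\<exists>C. cycle_set C \<and> C \<subseteq> EU U")
    case True
    then obtain C where C: "cycle_set C" "C \<subseteq> EU U" by blast
    \<comment> \<open>A subgraph built by ears that has the most edges; any ear inside
      \<open>U\<close> would enlarge it.\<close>
    define Q where "Q = (\<lambda>H. H \<subseteq> EU U \<and> (\<exists>\<F> C'. faces H \<F> C'))"
    have "Q C" using faces_cycle[OF C(1)] C(2) unfolding Q_def EU_def by blast
    moreover have "\<forall>H. Q H \<longrightarrow> card H \<le> card (EU U)" unfolding Q_def using fin card_mono by blast
    ultimately obtain H where H: "Q H" "\<And>H'. Q H' \<Longrightarrow> card H' \<le> card H"
      using ex_has_greatest_nat[of Q C card "Suc (card (EU U))"] by (metis less_Suc_eq_le)
    obtain \<F> C' where F: "faces H \<F> C'" and HU: "H \<subseteq> EU U" using H(1) unfolding Q_def by blast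
    define W where "W = \<Union>H"
    have WU: "W \<subseteq> U" using HU by (auto simp: W_def EU_def)
    have W2: "2 \<le> card W" using faces_bound[OF F] by (simp add: W_def)
    have noear: False
      if "distinct (a # zs @ [b])" "a \<in> W" "b \<in> W" "set zs \<inter> W = {}" "set zs \<subseteq> U"
        "path_edges (a # zs @ [b]) \<subseteq> E" "path_edges (a # zs @ [b]) \<inter> H = {}" for a b zs
    proof -
      define P where "P = path_edges (a # zs @ [b])"
      have "\<exists>\<F>' C'. faces (H \<union> P) \<F>' C'"
        by (rule faces_ear[OF F that(1)]) (use that in \<open>auto simp: W_def P_def\<close>)
      moreover have "e \<subseteq> U" if "e \<in> P" for e
        using path_edges_subset[OF that[unfolded P_def]] \<open>a \<in> W\<close> \<open>b \<in> W\<close> \<open>set zs \<subseteq> U\<close> WU by auto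
      then have "P \<subseteq> EU U" using that(6) unfolding EU_def P_def by blast
      ultimately have "Q (H \<union> P)" using HU unfolding Q_def by blast
      then have "card (H \<union> P) \<le> card H" by (rule H(2))
      moreover have "card (H \<union> P) = card H + card P"
        using that(7) HU fin finite_subset[of H] unfolding P_def by (intro card_Un_disjoint) auto
      moreover have "card P > 0" using card_path_edges[OF that(1)] by (simp add: P_def)
      ultimately show False by simp
    qed
    \<comment> \<open>A missing edge between two vertices of \<open>W\<close> is an ear without
      inner vertices.\<close>
    have chord: "e \<in> H" if e: "e \<in> E" "e \<subseteq> W" for e
    proof (rule ccontr)
      assume "e \<notin> H"
      obtain u v where "e = {u, v}" "u \<noteq> v" using two[OF e(1)] by blast
      then show False using noear[of u "[]" v] e \<open>e \<notin> H\<close> by auto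
    qed
    show ?thesis
    proof (cases "W = U")
      case True
      then have "EU U = H" using HU chord by (auto simp: EU_def)
      then show ?thesis using faces_bound[OF F] True by (simp add: W_def EU_def)
    next
      case False
      then obtain x where x: "x \<in> U - W" using WU by blast
      define R where "R = reachable E (U - W) x"
      have RU: "R \<subseteq> U - W" and xR: "x \<in> R" unfolding R_def by (rule reachable_subset, rule reachable_refl[OF x])
      \<comment> \<open>Edges from \<open>R\<close> to two different vertices of \<open>W\<close>,
        joined by a path in \<open>R\<close>'s component, would form an ear.\<close>
      have one: "a = b" if ab: "a \<in> W" "b \<in> W" "y \<in> R" "z \<in> R" "{a, y} \<in> E" "{b, z} \<in> E" for a b y z
      proof (rule ccontr)
        assume "a \<noteq> b"
        obtain p where p: "p \<noteq> []" "distinct p" "hd p = y" "last p = z" "set p \<subseteq> U - W" "path_edges p \<subseteq> E"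
          using reachable_path ab(3,4) unfolding R_def by metis
        have pe: "path_edges (a # p @ [b]) = insert {a, y} (insert {b, z} (path_edges p))"
          using p by (auto simp: path_edges_Cons path_edges_snoc insert_commute)
        have "e \<notin> H" if e: "e \<in> path_edges (a # p @ [b])" for e
        proof
          assume "e \<in> H"
          then have eW: "e \<subseteq> W" by (auto simp: W_def)
          have yz: "y \<notin> W" "z \<notin> W" using ab(3,4) RU by auto
          consider "e \<in> path_edges p" | "e = {a, y}" | "e = {b, z}" using e pe by auto
          then show False
          proof cases
            case 1
            obtain u v where "e = {u, v}" using two[of e] 1 p(6) by blast
            then have "u \<in> set p" "u \<in> W" using path_edges_subset[OF 1] eW by auto
            then show False using p(5) by blast
          qed (use eW yz in auto)
        qed
        then have disj: "path_edges (a # p @ [b]) \<inter> H = {}" by blast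
        have dist: "distinct (a # p @ [b])" using p(2,5) ab(1,2) \<open>a \<noteq> b\<close> by auto
        show False
          by (rule noear[OF dist ab(1,2) _ _ _ disj]) (use p(5,6) pe ab(5,6) in auto)
      qed
      have "\<exists>h\<in>W. \<forall>a\<in>W. \<forall>y\<in>R. {a, y} \<in> E \<longrightarrow> a = h"
      proof (cases "\<exists>a\<in>W. \<exists>y\<in>R. {a, y} \<in> E")
        case True
        then obtain h y where "h \<in> W" "y \<in> R" "{h, y} \<in> E" by blast
        then have "\<forall>a\<in>W. \<forall>z\<in>R. {a, z} \<in> E \<longrightarrow> a = h" using one[of _ h _ y] by blast
        then show ?thesis using \<open>h \<in> W\<close> by blast
      next
        case False
        moreover have "W \<noteq> {}" using W2 by auto
        ultimately show ?thesis by blast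
      qed
      then obtain h where h: "h \<in> W" "\<And>a y. a \<in> W \<Longrightarrow> y \<in> R \<Longrightarrow> {a, y} \<in> E \<Longrightarrow> a = h" by blast
      \<comment> \<open>Edges at \<open>R\<close> stay in \<open>R\<close> or lead to
        \<open>h\<close>, so the graph splits into two smaller ones that share only
        \<open>h\<close>.\<close>
      have "EU U \<subseteq> EU (U - R) \<union> EU (insert h R)"
      proof
        fix e assume e: "e \<in> EU U"
        show "e \<in> EU (U - R) \<union> EU (insert h R)"
        proof (cases "e \<inter> R = {}")
          case True
          then show ?thesis using e by (auto simp: EU_def)
        next
          case False
          then obtain y where y: "y \<in> e" "y \<in> R" by blast
          have "e \<in> E" using e by (simp add: EU_def)
          then obtain u v where "e = {u, v}" "u \<noteq> v" using two[of e] by blast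
          then obtain z where z: "e = {y, z}" using y by auto
          have "z \<in> U" using e z by (auto simp: EU_def)
          have "z \<in> insert h R"
          proof (cases "z \<in> W")
            case True
            then show ?thesis using h(2)[of z y] y e z by (auto simp: EU_def insert_commute)
          next
            case False
            then show ?thesis
              using reachable_step[of y E "U - W" x z] y e z \<open>z \<in> U\<close> by (auto simp: EU_def R_def)
          qed
          then show ?thesis using e z y by (auto simp: EU_def)
        qed
      qed
      then have "card (EU U) \<le> card (EU (U - R)) + card (EU (insert h R))"
        using fin by (meson card_Un_le card_mono finite_UnI le_trans)
      moreover have "4 * card (EU (U - R)) + 5 \<le> 5 * card (U - R)"
        by (rule IH) (use RU xR h WU in auto)
      moreover have "4 * card (EU (insert h R)) + 5 \<le> 5 * card (insert h R)"
      proof (rule IH)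
        have "\<not> W \<subseteq> insert h R"
        proof
          assume "W \<subseteq> insert h R"
          then have "W \<subseteq> {h}" using RU by auto
          then have "card W \<le> 1" by (metis card.empty card_insert_if card_mono empty_iff finite.intros le_refl One_nat_def)
          then show False using W2 by simp
        qed
        then show "insert h R \<subset> U" using RU h(1) WU by blast
      qed simp
      moreover have "finite R" using RU finU finite_subset by blast
      moreover have "h \<notin> R" using RU h(1) by blast
      moreover have "card (U - R) = card U - card R" "card R \<le> card U"
        using RU finU \<open>finite R\<close> by (auto intro!: card_Diff_subset card_mono)
      ultimately show ?thesis by (simp add: EU_def)
    qed
  next
    case False
    obtain v where v: "v \<in> U" using less.prems by blast
    show ?thesis
    proof (cases "U = {v}")
      case True
      have "EU U = {}"
      proof (rule ccontr)
        assume "EU U \<noteq> {}"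
        then obtain e where "e \<in> E" "e \<subseteq> {v}" using True by (auto simp: EU_def)
        then show False using two[of e] by auto
      qed
      then show ?thesis using True by (simp add: EU_def)
    next
      case U: False
      then obtain x where x: "x \<in> U - {v}" using v by blast
      define R where "R = reachable E (U - {v}) x"
      have RU: "R \<subseteq> U - {v}" and xR: "x \<in> R" unfolding R_def by (rule reachable_subset, rule reachable_refl[OF x])
      \<comment> \<open>Without cycles, \<open>v\<close> has at most one neighbour in each component
        of the rest; two would close a cycle through \<open>v\<close>.\<close>
      have one: "y = z" if yz: "y \<in> R" "z \<in> R" "{v, y} \<in> E" "{v, z} \<in> E" for y z
      proof (rule ccontr)
        assume "y \<noteq> z"
        obtain p where p: "p \<noteq> []" "distinct p" "hd p = y" "last p = z" "set p \<subseteq> U - {v}" "path_edges p \<subseteq> E"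
          using reachable_path yz(1,2) unfolding R_def by metis
        have len: "2 \<le> length p"
        proof (rule ccontr)
          assume "\<not> ?thesis"
          then have "\<exists>u. p = [u]" using p(1) by (cases p; cases "tl p") auto
          then show False using p(3,4) \<open>y \<noteq> z\<close> by auto
        qed
        define c where "c = v # p"
        have pe: "path_edges (c @ [hd c]) = insert {v, y} (insert {v, z} (path_edges p))"
          using p by (auto simp: c_def path_edges_Cons path_edges_snoc insert_commute)
        have "distinct c" "3 \<le> length c" using p len by (auto simp: c_def)
        then have "cycle_set (path_edges (c @ [hd c]))" unfolding cycle_set_def by blast
        moreover have "path_edges (c @ [hd c]) \<subseteq> EU U"
        proof
          fix e assume e: "e \<in> path_edges (c @ [hd c])"
          then have "e \<in> E" using pe p(6) yz by auto
          moreover have "e \<subseteq> U" using path_edges_subset[OF e] p(5) v by (auto simp: c_def)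
          ultimately show "e \<in> EU U" by (simp add: EU_def)
        qed
        ultimately show False using False by blast
      qed
      \<comment> \<open>If \<open>v\<close> has no neighbour in \<open>R\<close>, then
        \<open>y\<close> is arbitrary; the pair formed with it below only enlarges an upper bound.
        This single edge costs 4, less than the 5 gained from the second part.\<close>
      have "\<exists>y. \<forall>z\<in>R. {v, z} \<in> E \<longrightarrow> z = y"
      proof (cases "\<exists>y\<in>R. {v, y} \<in> E")
        case True
        then obtain y where "y \<in> R" "{v, y} \<in> E" by blast
        then have "\<forall>z\<in>R. {v, z} \<in> E \<longrightarrow> z = y" using one[of _ y] by blast
        then show ?thesis by blast
      qed blast
      then obtain y where y: "\<And>z. z \<in> R \<Longrightarrow> {v, z} \<in> E \<Longrightarrow> z = y" by metis
      have "EU U \<subseteq> EU (U - R) \<union> EU R \<union> {{v, y}}"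
      proof
        fix e assume e: "e \<in> EU U"
        show "e \<in> EU (U - R) \<union> EU R \<union> {{v, y}}"
        proof (cases "e \<inter> R = {}")
          case True
          then show ?thesis using e by (auto simp: EU_def)
        next
          case nR: False
          then obtain u where u: "u \<in> e" "u \<in> R" by blast
          have "e \<in> E" using e by (simp add: EU_def)
          then obtain u' v' where "e = {u', v'}" "u' \<noteq> v'" using two[of e] by blast
          then obtain z where z: "e = {u, z}" using u by auto
          have "z \<in> U" using e z by (auto simp: EU_def)
          show ?thesis
          proof (cases "z = v")
            case True
            then show ?thesis using y[of u] u e z by (auto simp: EU_def insert_commute)
          next
            case False
            then have "z \<in> R"
              using reachable_step[of u E "U - {v}" x z] u e z \<open>z \<in> U\<close> by (auto simp: EU_def R_def)
            then show ?thesis using e z u by (auto simp: EU_def)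
          qed
        qed
      qed
      then have "card (EU U) \<le> card (EU (U - R) \<union> EU R \<union> {{v, y}})"
        using fin by (intro card_mono) auto
      also have "\<dots> \<le> card (EU (U - R) \<union> EU R) + card {{v, y}}" by (rule card_Un_le)
      also have "\<dots> \<le> card (EU (U - R)) + card (EU R) + 1" using card_Un_le[of "EU (U - R)" "EU R"] by simp
      finally have "card (EU U) \<le> card (EU (U - R)) + card (EU R) + 1" .
      moreover have "4 * card (EU (U - R)) + 5 \<le> 5 * card (U - R)"
        by (rule IH) (use RU xR v in auto)
      moreover have "4 * card (EU R) + 5 \<le> 5 * card R"
        by (rule IH) (use RU xR v in auto)
      moreover have "finite R" using RU finU finite_subset by blast
      moreover have "card (U - R) = card U - card R" "card R \<le> card U"
        using RU finU \<open>finite R\<close> by (auto intro!: card_Diff_subset card_mono)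
      ultimately show ?thesis by (simp add: EU_def)
    qed
  qed
qed

section \<open>Degree sums and the induction over induced subgraphs\<close>

lemma card_neighbours:
  assumes "v \<in> U"
  shows "card {w \<in> U. {v, w} \<in> E} = card {e \<in> {e \<in> E. e \<subseteq> U}. v \<in> e}"
proof (rule bij_betw_same_card[of "\<lambda>w. {v, w}"])
  show "bij_betw (\<lambda>w. {v, w}) {w \<in> U. {v, w} \<in> E} {e \<in> {e \<in> E. e \<subseteq> U}. v \<in> e}"
  proof (rule bij_betw_imageI)
    show "inj_on (\<lambda>w. {v, w}) {w \<in> U. {v, w} \<in> E}" by (auto simp: inj_on_def doubleton_eq_iff)
    show "(\<lambda>w. {v, w}) ` {w \<in> U. {v, w} \<in> E} = {e \<in> {e \<in> E. e \<subseteq> U}. v \<in> e}"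
    proof
      show "{e \<in> {e \<in> E. e \<subseteq> U}. v \<in> e} \<subseteq> (\<lambda>w. {v, w}) ` {w \<in> U. {v, w} \<in> E}"
      proof
        fix e assume e: "e \<in> {e \<in> {e \<in> E. e \<subseteq> U}. v \<in> e}"
        then have "card e = 2" using edge by auto
        then obtain a b where "e = {a, b}" by (meson card_2_iff)
        then have "\<exists>w. e = {v, w}" using e by auto
        then show "e \<in> (\<lambda>w. {v, w}) ` {w \<in> U. {v, w} \<in> E}" using e by auto
      qed
    qed (use assms in auto)
  qed
qed

text \<open>The handshake identity for the subgraph induced on \<open>U\<close>, by exchanging the
  sums over vertices and edges.\<close>

lemma degree_sum:
  assumes "U \<subseteq> V"
  shows "(\<Sum>v\<in>U. card {w \<in> U. {v, w} \<in> E}) = 2 * card {e \<in> E. e \<subseteq> U}"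
proof -
  have finU: "finite U" using assms finite_subset finite_V by blast
  have "(\<Sum>v\<in>U. card {w \<in> U. {v, w} \<in> E}) = (\<Sum>v\<in>U. card {e \<in> {e \<in> E. e \<subseteq> U}. v \<in> e})"
    by (simp only: card_neighbours cong: sum.cong)
  also have "\<dots> = (\<Sum>v\<in>U. \<Sum>e | e \<in> {e \<in> E. e \<subseteq> U} \<and> v \<in> e. 1)" by simp
  also have "\<dots> = (\<Sum>e\<in>{e \<in> E. e \<subseteq> U}. \<Sum>v | v \<in> U \<and> v \<in> e. 1)"
    using finU by (intro sum.swap_restrict) auto
  also have "\<dots> = (\<Sum>e\<in>{e \<in> E. e \<subseteq> U}. 2)"
  proof (rule sum.cong)
    fix e assume e: "e \<in> {e \<in> E. e \<subseteq> U}"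
    then have "{v. v \<in> U \<and> v \<in> e} = e" by auto
    then show "(\<Sum>v | v \<in> U \<and> v \<in> e. 1) = (2::nat)" using e edge by simp
  qed simp
  finally show ?thesis by simp
qed

text \<open>The induction needs all induced subgraphs of minimum degree two, not just the given
  graph. For a minimal counterexample, discharging gives \<open>5 * card U\<close> as a lower bound
  for twice the degree sum, while \<open>edge_bound\<close> keeps it below that by 5.\<close>

lemma equitably_colorable_induced:
  assumes "4 \<le> n" "U \<subseteq> V" "\<And>v. v \<in> U \<Longrightarrow> 2 \<le> card {w \<in> U. {v, w} \<in> E}"
  shows "equitably_colorable U E n"
  using assms(2,3)
proof (induction "card U" arbitrary: U rule: less_induct)
  case less
  have "finite U" using less.prems(1) finite_subset finite_V by blast
  \<comment> \<open>The empty set is trivially colourable, and \<open>edge_bound\<close> requires a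
    vertex.\<close>
  have nonempty: "U \<noteq> {}" if "\<not> equitably_colorable U E n"
    using that
    by (auto simp: equitably_colorable_def equitable_coloring_def proper_coloring_def color_class_def)
  show ?case
  proof (rule ccontr)
    assume no: "\<not> equitably_colorable U E n"
    interpret minimal_counterexample V E n U
    proof
      fix W assume W: "W \<subset> U" "\<And>v. v \<in> W \<Longrightarrow> 2 \<le> card {w \<in> W. {v, w} \<in> E}"
      show "equitably_colorable W E n"
      proof (rule less.hyps)
        show "card W < card U" using W(1) \<open>finite U\<close> by (rule psubset_card_mono[rotated])
        show "W \<subseteq> V" using W(1) less.prems(1) by auto
      qed (rule W(2))
    qed (use graph girth assms(1) less.prems no in auto)
    have "2 * (\<Sum>v\<in>U. d v) = 4 * card {e \<in> E. e \<subseteq> U}"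
      using degree_sum[OF less.prems(1)] by (simp add: N_def)
    moreover have "4 * card {e \<in> E. e \<subseteq> U} + 5 \<le> 5 * card U"
      by (rule edge_bound[OF less.prems(1) nonempty[OF no]])
    ultimately show False using degree_sum_ge by simp
  qed
qed

end

theorem theorem1p3:
  fixes V :: "'a set" and E :: "'a set set"
  assumes "simple_graph V E"
    and "planar V E"
    and "min_degree V E \<ge> 2"
    and "girth V E \<ge> 10"
  shows "eq_chromatic_threshold V E \<le> 4 \<and> (\<forall>n\<ge>4. equitably_colorable V E n)"
proof -
  obtain pos \<gamma> where "plane_drawing V E pos \<gamma>" using assms(2) unfolding planar_def by blast
  then interpret plane_graph V E pos \<gamma> using assms by unfold_locales
  have "2 \<le> card {w \<in> V. {v, w} \<in> E}" if v: "v \<in> V" for v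
  proof -
    have "min_degree V E \<le> enat (vertex_degree E v)" unfolding min_degree_def using v by (rule INF_lower)
    then have "enat 2 \<le> enat (vertex_degree E v)" using assms(3) order_trans by (metis numeral_eq_enat)
    \<comment> \<open>Edges lie within \<open>V\<close>, so the degree counted by edges equals the
      number of neighbours in \<open>V\<close>.\<close>
    moreover have "{e \<in> {e \<in> E. e \<subseteq> V}. v \<in> e} = {e \<in> E. v \<in> e}" using edge by auto
    then have "vertex_degree E v = card {w \<in> V. {v, w} \<in> E}"
      using card_neighbours[OF v] by (simp add: vertex_degree_def)
    ultimately show ?thesis by simp
  qed
  then have all: "\<forall>n\<ge>4. equitably_colorable V E n"
    using equitably_colorable_induced[OF _ subset_refl] by simp
  then show ?thesis unfolding eq_chromatic_threshold_def by (simp add: Least_le)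
qed

end
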